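(* Let $\mathcal{F}=\{f_k\}_{k=1}^m$ be a CPLIFS whose generated self-similar IFS $\mathcal{S}_{\mathcal{F}}$ has no exact overlapping. Then for every $\varepsilon>0$ there exists $\delta>0$ such that for every CPLIFS $\widehat{\mathcal{F}}=\{\widehat f_k\}_{k=1}^m$ which is $\delta$-close to $\mathcal{F}$, \[ |s_{\mathcal{F}}-s_{\widehat{\mathcal{F}}}|<\varepsilon, \] where $s_{\mathcal{F}}$ and $s_{\widehat{\mathcal{F}}}$ are the natural dimensions of $\mathcal{F}$ and $\widehat{\mathcal{F}}$.
   Context: A CPLIFS (continuous piecewise linear iterated function system) is a family $\mathcal{F}=\{f_k\}_{k=1}^m$, $m\ge 2$, of continuous piecewise linear maps $f_k:\mathbb{R}\to\mathbb{R}$, where $f_k$ has finitely many breaking points $b_{k,1}<\dots<b_{k,l(k)}$ ($l(k)\ge 0$), which determine the open intervals of linearity $J_{k,1}=(-\infty,b_{k,1})$, $J_{k,i}=(b_{k,i-1},b_{k,i})$ for $2\le i\le l(k)$, $J_{k,l(k)+1}=(b_{k,l(k)},\infty)$; on $J_{k,i}$ the map $f_k$ has constant slope $\rho_{k,i}\in(-1,1)\setminus\{0\}$, with $\rho_{k,i}\neq\rho_{k,i+1}$. Let $I=[u,v]$ be the smallest nonempty compact interval with $f_k(I)\subset I$ for all $k$ (if all $f_k$ share a common fixed point $\phi$ so that the attractor is a point, set $I=[\phi-\tfrac12,\phi+\tfrac12]$). The attractor $\Lambda$ is the unique nonempty compact set with $\Lambda=\bigcup_k f_k(\Lambda)$.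 Cylinder intervals: $I_{i_1\dots i_n}=f_{i_1}\circ\dots\circ f_{i_n}(I)$. Natural pressure: $\Phi(s)=\limsup_{n\to\infty}\frac1n\log\sum_{(i_1,\dots,i_n)\in[m]^n}|I_{i_1\dots i_n}|^s$; it is strictly decreasing on $[0,\infty)$ with $\Phi(0)>0$ and $\Phi(s)\to-\infty$, and the natural dimension $s_{\mathcal{F}}$ is its unique zero. Generated self-similar IFS: $\mathcal{S}_{\mathcal{F}}=\{S_{k,i}\}_{k\in[m],i\in[l(k)+1]}$, where $S_{k,i}(x)=\rho_{k,i}x+t_{k,i}$ is the similarity agreeing with $f_k$ on $J_{k,i}$. A self-similar IFS $\{S_a\}_{a\in\mathcal{A}}$ has no exact overlapping if for every $n\ge1$ and words $\mathbf{i},\mathbf{j}\in\mathcal{A}^n$, $S_{\mathbf{i}}\equiv S_{\mathbf{j}}$ implies $\mathbf{i}=\mathbf{j}$ (where $S_{a_1\dots a_n}=S_{a_1}\circ\dots\circ S_{a_n}$). Monotonicity partition: let $\mathcal{I}=\bigcup_k f_k(I)$ and, for each $k,j$, let the branch $f_{k,j}^{-1}:f_k(J_{k,j})\to J_{k,j}$ be the inverse of $f_k|_{J_{k,j}}$. The set of critical points is $\mathcal{K}=\{f_k(u),f_k(v):k\in[m]\}\cup\{f_k(b_{k,j}):k\in[m],j\in[l(k)]\}\cup\{x\in\mathcal{I}:\exists\,(k_1,j_1)\neq(k_2,j_2)\text{ with }f^{-1}_{k_1,j_1}(x)=f^{-1}_{k_2,j_2}(x)\}$. The monotonicity partition $\mathcal{Z}_0$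 is the partition of $\mathcal{I}$ into closed intervals determined by $\mathcal{K}$. Closeness: two closed intervals $[c,d],[\hat c,\hat d]$ are $\varepsilon$-close if $|c-\hat c|<\varepsilon$ and $|d-\hat d|<\varepsilon$; two finite partitions $\{Y_1,\dots,Y_N\}$, $\{\widehat Y_1,\dots,\widehat Y_N\}$ (same cardinality, ordered left to right) are $\varepsilon$-close if $Y_j,\widehat Y_j$ are $\varepsilon$-close for all $j$. Two CPLIFSs $\mathcal{F}=\{f_k\}$, $\widehat{\mathcal{F}}=\{\widehat f_k\}$ are $\varepsilon$-close if (a) their monotonicity partitions are $\varepsilon$-close, (b) $f_k$ and $\widehat f_k$ have the same number of breaking points for all $k$, (c) $|\log|\rho_{k,j}|-\log|\widehat\rho_{k,j}||<\varepsilon$ for all $k,j$ (slopes of $f_k$ and $\widehat f_k$ on corresponding intervals of linearity), (d) $\|f_k-\widehat f_k\|_\infty<\varepsilon$ for all $k$. *)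

theory Defs
  imports Complex_Main "HOL-Library.Extended_Real" "HOL-Library.Liminf_Limsup"
begin

text \<open>A CPLIFS with m maps is represented by three families indexed by k < m:
  f k : the map f_k (the maps are f 0, ..., f (m-1));
  bs k : the strictly increasing list of breaking points b_{k,1} < ... < b_{k,l(k)};
  rs k : the list of slopes rho_{k,1}, ..., rho_{k,l(k)+1}.
  Indices of intervals of linearity are shifted to start at 0: interval i (i \<le> l(k))
  lies between breaking point i-1 and breaking point i (0-based list positions).\<close>

definition lin_int :: "(nat \<Rightarrow> real list) \<Rightarrow> nat \<Rightarrow> nat \<Rightarrow> real set" where
  "lin_int bs k i = {x. (i = 0 \<or> bs k ! (i - 1) < x) \<and> (i = length (bs k) \<or> x < bs k ! i)}"

definition is_CPLIFS :: "nat \<Rightarrow> (nat \<Rightarrow> real \<Rightarrow> real) \<Rightarrow> (nat \<Rightarrow> real list) \<Rightarrow> (nat \<Rightarrow> real list) \<Rightarrow> bool" where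
  "is_CPLIFS m f bs rs \<longleftrightarrow> m \<ge> 2 \<and>
     (\<forall>k<m. sorted_wrt (<) (bs k) \<and> length (rs k) = length (bs k) + 1 \<and>
        continuous_on UNIV (f k) \<and>
        (\<forall>i\<le>length (bs k). -1 < rs k ! i \<and> rs k ! i < 1 \<and> rs k ! i \<noteq> 0 \<and>
            (\<exists>t. \<forall>x\<in>lin_int bs k i. f k x = rs k ! i * x + t)) \<and>
        (\<forall>i<length (bs k). rs k ! i \<noteq> rs k ! (Suc i)))"

definition sim_trans :: "(nat \<Rightarrow> real \<Rightarrow> real) \<Rightarrow> (nat \<Rightarrow> real list) \<Rightarrow> (nat \<Rightarrow> real list) \<Rightarrow> nat \<Rightarrow> nat \<Rightarrow> real" where
  "sim_trans f bs rs k i = (SOME t. \<forall>x\<in>lin_int bs k i. f k x = rs k ! i * x + t)"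

definition sim_map :: "(nat \<Rightarrow> real \<Rightarrow> real) \<Rightarrow> (nat \<Rightarrow> real list) \<Rightarrow> (nat \<Rightarrow> real list) \<Rightarrow> nat \<Rightarrow> nat \<Rightarrow> real \<Rightarrow> real" where
  "sim_map f bs rs k i x = rs k ! i * x + sim_trans f bs rs k i"

definition sim_alphabet :: "nat \<Rightarrow> (nat \<Rightarrow> real list) \<Rightarrow> (nat \<times> nat) set" where
  "sim_alphabet m bs = {(k, i). k < m \<and> i \<le> length (bs k)}"

definition sim_word :: "(nat \<Rightarrow> real \<Rightarrow> real) \<Rightarrow> (nat \<Rightarrow> real list) \<Rightarrow> (nat \<Rightarrow> real list) \<Rightarrow> (nat \<times> nat) list \<Rightarrow> real \<Rightarrow> real" where
  "sim_word f bs rs w = foldr (\<lambda>(k, i) g. sim_map f bs rs k i \<circ> g) w id"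

definition no_exact_overlap :: "nat \<Rightarrow> (nat \<Rightarrow> real \<Rightarrow> real) \<Rightarrow> (nat \<Rightarrow> real list) \<Rightarrow> (nat \<Rightarrow> real list) \<Rightarrow> bool" where
  "no_exact_overlap m f bs rs \<longleftrightarrow>
     (\<forall>n\<ge>1. \<forall>w w'. length w = n \<and> length w' = n \<and> set w \<subseteq> sim_alphabet m bs \<and>
        set w' \<subseteq> sim_alphabet m bs \<and> sim_word f bs rs w = sim_word f bs rs w' \<longrightarrow> w = w')"

definition base_int :: "nat \<Rightarrow> (nat \<Rightarrow> real \<Rightarrow> real) \<Rightarrow> real set" where
  "base_int m f =
     (if \<exists>\<phi>. \<forall>k<m. f k \<phi> = \<phi>
      then (let \<phi> = (SOME \<phi>. \<forall>k<m. f k \<phi> = \<phi>) in {\<phi> - 1/2 .. \<phi> + 1/2})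
      else \<Inter> {{a..b} | a b. a \<le> b \<and> (\<forall>k<m. f k ` {a..b} \<subseteq> {a..b})})"

definition words :: "nat \<Rightarrow> nat \<Rightarrow> nat list set" where
  "words m n = {w. length w = n \<and> set w \<subseteq> {..<m}}"

definition comp_word :: "(nat \<Rightarrow> real \<Rightarrow> real) \<Rightarrow> nat list \<Rightarrow> real \<Rightarrow> real" where
  "comp_word f w = foldr (\<lambda>k g. f k \<circ> g) w id"

definition ilen :: "real set \<Rightarrow> real" where
  "ilen S = Sup S - Inf S"

definition cylinder :: "nat \<Rightarrow> (nat \<Rightarrow> real \<Rightarrow> real) \<Rightarrow> nat list \<Rightarrow> real set" where
  "cylinder m f w = comp_word f w ` base_int m f"

definition nat_pressure :: "nat \<Rightarrow> (nat \<Rightarrow> real \<Rightarrow> real) \<Rightarrow> real \<Rightarrow> ereal" where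
  "nat_pressure m f s =
     limsup (\<lambda>n. ereal (ln (\<Sum>w\<in>words m n. ilen (cylinder m f w) powr s) / real n))"

definition nat_dim :: "nat \<Rightarrow> (nat \<Rightarrow> real \<Rightarrow> real) \<Rightarrow> real" where
  "nat_dim m f = (THE s. 0 \<le> s \<and> nat_pressure m f s = 0)"

definition img_union :: "nat \<Rightarrow> (nat \<Rightarrow> real \<Rightarrow> real) \<Rightarrow> real set" where
  "img_union m f = (\<Union>k<m. f k ` base_int m f)"

definition crit_pts :: "nat \<Rightarrow> (nat \<Rightarrow> real \<Rightarrow> real) \<Rightarrow> (nat \<Rightarrow> real list) \<Rightarrow> real set" where
  "crit_pts m f bs =
     {f k (Inf (base_int m f)) | k. k < m} \<union> {f k (Sup (base_int m f)) | k. k < m}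
     \<union> {f k (bs k ! j) | k j. k < m \<and> j < length (bs k)}
     \<union> {x \<in> img_union m f. \<exists>k1 j1 k2 j2. k1 < m \<and> k2 < m \<and> j1 \<le> length (bs k1) \<and>
           j2 \<le> length (bs k2) \<and> (k1, j1) \<noteq> (k2, j2) \<and>
           x \<in> f k1 ` lin_int bs k1 j1 \<and> x \<in> f k2 ` lin_int bs k2 j2 \<and>
           inv_into (lin_int bs k1 j1) (f k1) x = inv_into (lin_int bs k2 j2) (f k2) x}"

definition mono_partition :: "nat \<Rightarrow> (nat \<Rightarrow> real \<Rightarrow> real) \<Rightarrow> (nat \<Rightarrow> real list) \<Rightarrow> (real \<times> real) list" where
  "mono_partition m f bs =
     (let pts = sorted_list_of_set (crit_pts m f bs \<inter> img_union m f)
      in filter (\<lambda>(c, d). {c..d} \<subseteq> img_union m f) (zip pts (tl pts)))"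

definition partitions_close :: "real \<Rightarrow> (real \<times> real) list \<Rightarrow> (real \<times> real) list \<Rightarrow> bool" where
  "partitions_close \<epsilon> P Q \<longleftrightarrow> length P = length Q \<and>
     (\<forall>j<length P. \<bar>fst (P ! j) - fst (Q ! j)\<bar> < \<epsilon> \<and> \<bar>snd (P ! j) - snd (Q ! j)\<bar> < \<epsilon>)"

definition cplifs_close :: "real \<Rightarrow> nat \<Rightarrow>
    (nat \<Rightarrow> real \<Rightarrow> real) \<Rightarrow> (nat \<Rightarrow> real list) \<Rightarrow> (nat \<Rightarrow> real list) \<Rightarrow>
    (nat \<Rightarrow> real \<Rightarrow> real) \<Rightarrow> (nat \<Rightarrow> real list) \<Rightarrow> (nat \<Rightarrow> real list) \<Rightarrow> bool" where
  "cplifs_close \<epsilon> m f bs rs g cs qs \<longleftrightarrow>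
     finite (crit_pts m f bs \<inter> img_union m f) \<and> finite (crit_pts m g cs \<inter> img_union m g) \<and>
     partitions_close \<epsilon> (mono_partition m f bs) (mono_partition m g cs) \<and>
     (\<forall>k<m. length (bs k) = length (cs k)) \<and>
     (\<forall>k<m. \<forall>j\<le>length (bs k). \<bar>ln \<bar>rs k ! j\<bar> - ln \<bar>qs k ! j\<bar>\<bar> < \<epsilon>) \<and>
     (\<forall>k<m. (SUP x. ereal \<bar>f k x - g k x\<bar>) < ereal \<epsilon>)"

end

theory Submission
  imports Defs "HOL-Analysis.Analysis"
begin

text \<open>
  Without exact overlaps no breaking point of a map of the system returns to itself under a
  composition that starts with that map. By finiteness, any \<open>N\<close> consecutive steps of an orbit pass
  within a small distance \<open>r\<close> of each breaking point at most once. A nearby system has its breaking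
  points within \<open>r\<close> of the original ones, because the second difference of a map detects a change of
  slope, and its orbits shadow the original ones. Hence the lengths of the cylinders of the two
  systems for a word of length \<open>n\<close> differ by a factor of at most \<open>exp (K + \<eta> n)\<close>, where \<open>\<eta>\<close> is
  small when \<open>N\<close> is large and the systems are close. So the pressures at \<open>s\<close> differ by at most
  \<open>s \<eta>\<close>, and since the pressure decreases at a definite linear rate, its zeros are close.
\<close>

section \<open>Piecewise affine maps\<close>

text \<open>The obstacle is a cylinder with a breaking point inside. The factor by which the next
  map shrinks it depends on where the breaking point sits in the cylinder, and deep cylinders are
  far shorter than any fixed \<delta>, so closeness of the systems yields no better than a constant
  bound \<open>C\<close> for the error of such a step. Away from breaking points the error is only a
  difference of logarithms of slopes. Hence the bad steps have to be rare, and this is what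
  excluding returns achieves. The constants must be fixed in the order \<open>C\<close>,
  \<open>N\<close>, \<open>r\<close>, \<delta>: \<open>N\<close> has to outweigh \<open>C\<close>,
  which therefore has to hold for all nearby systems at once, and the available separation may
  shrink as \<open>N\<close> grows. The constant \<open>K\<close> may depend on the perturbed
  system, because division by the word length removes it in the limit.\<close>

definition piece :: "real list \<Rightarrow> nat \<Rightarrow> real set" where
  "piece b i = {x. (i = 0 \<or> b ! (i - 1) \<le> x) \<and> (i = length b \<or> x \<le> b ! i)}"

text \<open>Take the least \<open>i\<close> whose right boundary is not left of \<open>q\<close>. By
  minimality breaking point \<open>i - 1\<close> lies left of \<open>q\<close>, hence not right of
  \<open>p\<close>.\<close>

lemma interval_subset_piece:
  assumes "p \<le> q" "\<And>j. j < length b \<Longrightarrow> b ! j \<le> p \<or> q \<le> b ! j"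
  shows "\<exists>i\<le>length b. {p..q} \<subseteq> piece b i"
proof -
  define P where "P = (\<lambda>i. i = length b \<or> q \<le> b ! i)"
  define i where "i = (LEAST i. P i)"
  have Pl: "P (length b)" by (simp add: P_def)
  have Pi: "P i" unfolding i_def by (rule LeastI[of P, OF Pl])
  have il: "i \<le> length b" unfolding i_def by (rule Least_le[of P, OF Pl])
  have "i = 0 \<or> b ! (i - 1) \<le> p"
  proof (cases "i = 0")
    case False
    then have "\<not> P (i - 1)" using not_less_Least[of "i - 1" P] by (simp add: i_def)
    then show ?thesis using assms(2)[of "i - 1"] il False by (auto simp: P_def)
  qed simp
  then have "{p..q} \<subseteq> piece b i" using Pi unfolding piece_def P_def by fastforce
  then show ?thesis using il by blast
qed

lemma ex_piece: "\<exists>i\<le>length b. x \<in> piece b i"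
  using interval_subset_piece[of x x b] by (metis atLeastAtMost_singleton insert_subset linear order_refl)

text \<open>The formulas hold on closed pieces, so those of neighbouring pieces agree at their
  common breaking point. This is how continuity enters.\<close>

locale pl_map =
  fixes h :: "real \<Rightarrow> real" and b :: "real list" and \<rho> \<tau> :: "nat \<Rightarrow> real"
  assumes affine: "\<And>i x. i \<le> length b \<Longrightarrow> x \<in> piece b i \<Longrightarrow> h x = \<rho> i * x + \<tau> i"
    and sorted: "sorted_wrt (<) b"
begin

lemma piece_Suc_bounds:
  assumes "Suc i \<le> length b" "b ! i \<le> x" "Suc i = length b \<or> x \<le> b ! Suc i"
  shows "x \<in> piece b (Suc i)"
  using assms by (auto simp: piece_def)

lemma lipschitz:
  assumes L: "\<And>i. i \<le> length b \<Longrightarrow> \<bar>\<rho> i\<bar> \<le> L"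
  shows "\<bar>h x - h y\<bar> \<le> L * \<bar>x - y\<bar>"
proof -
  have one: "\<bar>h x - h y\<bar> \<le> L * \<bar>x - y\<bar>" if "i \<le> length b" "x \<in> piece b i" "y \<in> piece b i" for i x y
  proof -
    have "h x - h y = \<rho> i * (x - y)" using that affine by (simp add: algebra_simps)
    then show ?thesis using L[OF that(1)] by (simp add: abs_mult mult_right_mono)
  qed
  \<comment> \<open>Induction over the breaking points from left to right; an interval that crosses
    breaking point \<open>i\<close> is cut there and the two estimates add up.\<close>
  have "\<bar>h x - h y\<bar> \<le> L * (y - x)"
    if "i \<le> length b" "x \<le> y" "i = length b \<or> y \<le> b ! i" for i x y
    using that
  proof (induction i arbitrary: x y)
    case 0
    then show ?case using one[of 0 x y] by (auto simp: piece_def)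
  next
    case (Suc i)
    have IH: "\<bar>h x - h y\<bar> \<le> L * (y - x)" if "x \<le> y" "y \<le> b ! i" for x y
      using Suc.IH[of x y] that Suc.prems by simp
    have A: "\<bar>h x - h y\<bar> \<le> L * (y - x)" if "x \<le> y" "b ! i \<le> x" "Suc i = length b \<or> y \<le> b ! Suc i" for x y
      using one[of "Suc i" x y] piece_Suc_bounds[of i x] piece_Suc_bounds[of i y] that Suc.prems(1) by force
    consider "y \<le> b ! i" | "b ! i \<le> x" | "x \<le> b ! i" "b ! i \<le> y" by linarith
    then show ?case
    proof cases
      case 3
      have "\<bar>h x - h (b ! i)\<bar> \<le> L * (b ! i - x)" "\<bar>h (b ! i) - h y\<bar> \<le> L * (y - b ! i)"
        using IH[of x "b ! i"] A[of "b ! i" y] 3 Suc.prems by auto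
      then show ?thesis by (simp add: algebra_simps)
    qed (use IH A Suc.prems in auto)
  qed
  from this[of "length b" "min x y" "max x y"] show ?thesis
    by (cases "x \<le> y") (auto simp: abs_minus_commute)
qed

text \<open>The map may fold the interval, so its endpoints can have equal images and two inner
  points have to be found. Cutting at a breaking point and keeping the longer part costs a factor 2
  each time.\<close>

lemma expansion:
  assumes c: "\<And>i. i \<le> length b \<Longrightarrow> c \<le> \<bar>\<rho> i\<bar>" "0 \<le> c" and "x \<le> y"
  shows "\<exists>x'\<in>{x..y}. \<exists>y'\<in>{x..y}. c * (y - x) / 2 ^ length b \<le> \<bar>h x' - h y'\<bar>"
proof -
  have one: "c * \<bar>x - y\<bar> \<le> \<bar>h x - h y\<bar>" if "i \<le> length b" "x \<in> piece b i" "y \<in> piece b i" for i x y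
  proof -
    have "h x - h y = \<rho> i * (x - y)" using that affine by (simp add: algebra_simps)
    then show ?thesis using c(1)[OF that(1)] by (simp add: abs_mult mult_right_mono)
  qed
  have "\<exists>x'\<in>{x..y}. \<exists>y'\<in>{x..y}. c * (y - x) / 2 ^ i \<le> \<bar>h x' - h y'\<bar>"
    if "i \<le> length b" "x \<le> y" "i = length b \<or> y \<le> b ! i" for i x y
    using that
  proof (induction i arbitrary: x y)
    case 0
    then show ?case using one[of 0 x y] by (intro bexI[of _ x] bexI[of _ y]) (auto simp: piece_def)
  next
    case (Suc i)
    have IH: "\<exists>x'\<in>{x..y}. \<exists>y'\<in>{x..y}. c * (y - x) / 2 ^ i \<le> \<bar>h x' - h y'\<bar>" if "x \<le> y" "y \<le> b ! i" for x y
      using Suc.IH[of x y] that Suc.prems by simp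
    have A: "c * (y - x) \<le> \<bar>h x - h y\<bar>" if "x \<le> y" "b ! i \<le> x" "Suc i = length b \<or> y \<le> b ! Suc i" for x y
      using one[of "Suc i" x y] piece_Suc_bounds[of i x] piece_Suc_bounds[of i y] that Suc.prems(1) by force
    \<comment> \<open>The cut: breaking point \<open>i\<close> clamped to the interval from
      \<open>x\<close> to \<open>y\<close>. Left of \<open>z\<close> the induction hypothesis
      applies, right of it the map is affine.\<close>
    define z where "z = min y (max x (b ! i))"
    have z: "x \<le> z" "z \<le> y" using Suc.prems by (auto simp: z_def)
    show ?case
    proof (cases "y - x \<le> 2 * (z - x)")
      case True
      have "z \<le> b ! i" if "x < z" using that by (auto simp: z_def min_def max_def split: if_splits)
      then have "\<exists>x'\<in>{x..z}. \<exists>y'\<in>{x..z}. c * (z - x) / 2 ^ i \<le> \<bar>h x' - h y'\<bar>"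
        using IH[of x z] z by (cases "x < z") auto
      then obtain x' y' where xy: "x' \<in> {x..z}" "y' \<in> {x..z}" "c * (z - x) / 2 ^ i \<le> \<bar>h x' - h y'\<bar>" by blast
      have "c * (y - x) \<le> c * (2 * (z - x))" by (rule mult_left_mono[OF True c(2)])
      then have "c * (y - x) / 2 \<le> c * (z - x)" unfolding mult.left_commute[of c 2] by linarith
      then have "c * (y - x) / 2 / 2 ^ i \<le> c * (z - x) / 2 ^ i" by (intro divide_right_mono) auto
      then have "c * (y - x) / 2 ^ Suc i \<le> c * (z - x) / 2 ^ i" by simp
      then show ?thesis using xy z by (intro bexI[of _ x'] bexI[of _ y']) auto
    next
      case False
      then have "z \<noteq> y" using Suc.prems(2) by auto
      then have "z < y" using z by simp
      then have "b ! i \<le> z" by (auto simp: z_def min_def max_def split: if_splits)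
      then have "c * (y - z) \<le> \<bar>h z - h y\<bar>" using A[of z y] z Suc.prems by auto
      moreover have "c * (y - x) \<le> c * (2 * (y - z))" using False c(2) by (intro mult_left_mono) auto
      moreover have "c * (y - x) / 2 ^ Suc i \<le> c * (y - x) / 2"
        using c(2) Suc.prems(2) by (intro divide_left_mono) (auto simp: mult_nonneg_nonneg)
      ultimately have "c * (y - x) / 2 ^ Suc i \<le> \<bar>h z - h y\<bar>"
        unfolding mult.left_commute[of c 2] by linarith
      then show ?thesis using z by (intro bexI[of _ z] bexI[of _ y]) auto
    qed
  qed
  from this[of "length b" x y] assms(3) show ?thesis by simp
qed

end

section \<open>Lengths of images of intervals\<close>

lemma ilen_interval [simp]: "p \<le> q \<Longrightarrow> ilen {p..q} = q - p"
  by (simp add: ilen_def)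

lemma image_interval:
  fixes h :: "real \<Rightarrow> real"
  assumes "p < q" "continuous_on UNIV h" "x \<in> {p..q}" "y \<in> {p..q}" "h x \<noteq> h y"
  shows "\<exists>p' q'. p' < q' \<and> h ` {p..q} = {p'..q'}"
proof -
  have "continuous_on {p..q} h" using assms(2) by (rule continuous_on_subset) simp
  then obtain c d where cd: "h ` {p..q} = {c..d}" "c \<le> d"
    using continuous_image_closed_interval[of p q h] assms(1) by auto
  have "h x \<in> {c..d}" "h y \<in> {c..d}" using cd(1) assms(3,4) by blast+
  then have "c < d" using assms(5) by auto
  then show ?thesis using cd by blast
qed

lemma ilen_image_le:
  assumes "p < q" "p' < q'" "h ` {p..q} = {p'..q'}"
    and "\<And>x y. x \<in> {p..q} \<Longrightarrow> y \<in> {p..q} \<Longrightarrow> \<bar>h x - h y\<bar> \<le> L * \<bar>x - y\<bar>" "0 \<le> L"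
  shows "ilen (h ` {p..q}) \<le> L * (q - p)"
proof -
  obtain x y where xy: "x \<in> {p..q}" "y \<in> {p..q}" "h x = p'" "h y = q'"
    using assms(2,3) by (metis (no_types, lifting) atLeastAtMost_iff imageE less_imp_le order_refl)
  have "q' - p' \<le> L * \<bar>x - y\<bar>" using assms(2) assms(4)[OF xy(1,2)] xy by simp
  also have "\<dots> \<le> L * (q - p)" using xy assms(5) by (intro mult_left_mono) auto
  finally show ?thesis using assms(2,3) by simp
qed

lemma ilen_image_ge:
  assumes "p' < q'" "h ` {p..q} = {p'..q'}" "x \<in> {p..q}" "y \<in> {p..q}"
  shows "\<bar>h x - h y\<bar> \<le> ilen (h ` {p..q})"
proof -
  have "h x \<in> {p'..q'}" "h y \<in> {p'..q'}" using assms by blast+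
  then show ?thesis using assms(1,2) by auto
qed

section \<open>Elementary properties of a CPLIFS\<close>

lemma CPLIFS_D:
  assumes "is_CPLIFS m f bs rs"
  shows "2 \<le> m" and "k < m \<Longrightarrow> sorted_wrt (<) (bs k)"
    and "k < m \<Longrightarrow> continuous_on UNIV (f k)"
    and "k < m \<Longrightarrow> i \<le> length (bs k) \<Longrightarrow> \<bar>rs k ! i\<bar> < 1"
    and "k < m \<Longrightarrow> i \<le> length (bs k) \<Longrightarrow> rs k ! i \<noteq> 0"
    and "k < m \<Longrightarrow> i < length (bs k) \<Longrightarrow> rs k ! i \<noteq> rs k ! Suc i"
  using assms unfolding is_CPLIFS_def abs_less_iff by (auto simp: minus_less_iff)

text \<open>By continuity the set where \<open>f k\<close> agrees with the similarity is closed, and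
  \<open>piece\<close> is the closure of \<open>lin_int\<close>; strict order of the breaking points
  makes this true for bounded pieces.\<close>

lemma CPLIFS_affine:
  assumes F: "is_CPLIFS m f bs rs" and k: "k < m" and i: "i \<le> length (bs k)" and x: "x \<in> piece (bs k) i"
  shows "f k x = sim_map f bs rs k i x"
proof -
  define A where "A = {x. f k x = sim_map f bs rs k i x}"
  have "\<exists>t. \<forall>x\<in>lin_int bs k i. f k x = rs k ! i * x + t"
    using F k i unfolding is_CPLIFS_def by blast
  then have "\<forall>x\<in>lin_int bs k i. f k x = rs k ! i * x + sim_trans f bs rs k i"
    unfolding sim_trans_def by (rule someI_ex)
  then have sub: "lin_int bs k i \<subseteq> A" by (auto simp: A_def sim_map_def)
  have "closed A" unfolding A_def sim_map_def
    using CPLIFS_D(3)[OF F k] by (intro closed_Collect_eq continuous_intros) auto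
  then have "closure (lin_int bs k i) \<subseteq> A" using sub by (rule closure_minimal[rotated])
  moreover have "x \<in> closure (lin_int bs k i)"
  proof -
    consider "i = 0" "i = length (bs k)" | "i = 0" "i < length (bs k)"
      | "i > 0" "i = length (bs k)" | "i > 0" "i < length (bs k)" using i by linarith
    then show ?thesis
    proof cases
      case 1
      then have "lin_int bs k i = UNIV" by (auto simp: lin_int_def)
      then show ?thesis by simp
    next
      case 2
      then have "lin_int bs k i = {..<bs k ! i}" by (auto simp: lin_int_def)
      then show ?thesis using x 2 by (simp add: piece_def)
    next
      case 3
      then have "lin_int bs k i = {bs k ! (i - 1)<..}" by (auto simp: lin_int_def)
      then show ?thesis using x 3 by (simp add: piece_def)
    next
      case 4
      then have "lin_int bs k i = {bs k ! (i - 1)<..<bs k ! i}" by (auto simp: lin_int_def)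
      moreover have "bs k ! (i - 1) < bs k ! i"
        using CPLIFS_D(2)[OF F k] 4 by (simp add: sorted_wrt_iff_nth_less)
      ultimately show ?thesis using x 4 by (simp add: piece_def)
    qed
  qed
  ultimately show ?thesis by (auto simp: A_def)
qed

lemma CPLIFS_pl_map:
  assumes "is_CPLIFS m f bs rs" "k < m"
  shows "pl_map (f k) (bs k) (\<lambda>i. rs k ! i) (sim_trans f bs rs k)"
  using CPLIFS_affine[OF assms] CPLIFS_D(2)[OF assms] by unfold_locales (auto simp: sim_map_def)

lemma finite_sim_alphabet: "finite (sim_alphabet m bs)"
proof -
  have "sim_alphabet m bs = (SIGMA k:{..<m}. {..length (bs k)})" by (auto simp: sim_alphabet_def)
  then show ?thesis by simp
qed

lemma CPLIFS_slope_bounds: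
  assumes F: "is_CPLIFS m f bs rs"
  obtains c L :: real where "0 < c" "0 < L" "L < 1"
    "\<And>k i. k < m \<Longrightarrow> i \<le> length (bs k) \<Longrightarrow> c \<le> \<bar>rs k ! i\<bar>"
    "\<And>k i. k < m \<Longrightarrow> i \<le> length (bs k) \<Longrightarrow> \<bar>rs k ! i\<bar> \<le> L"
proof -
  define R where "R = (\<lambda>(k, i). \<bar>rs k ! i\<bar>) ` sim_alphabet m bs"
  have fin: "finite R" by (simp add: R_def finite_sim_alphabet)
  have R: "0 < y \<and> y < 1" if "y \<in> R" for y
    using that CPLIFS_D[OF F] by (auto simp: R_def sim_alphabet_def)
  have mem: "\<bar>rs k ! i\<bar> \<in> R" if "k < m" "i \<le> length (bs k)" for k i
    using that by (auto simp: R_def sim_alphabet_def)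
  have ne: "R \<noteq> {}" using mem[of 0 0] CPLIFS_D(1)[OF F] by force
  show ?thesis
  proof
    show "0 < Min R" "0 < Max R" "Max R < 1"
      using R[of "Min R"] R[of "Max R"] Min_in[OF fin ne] Max_in[OF fin ne] by auto
  qed (use mem fin in auto)
qed

lemma CPLIFS_lipschitz:
  assumes "is_CPLIFS m f bs rs" "k < m" "\<And>i. i \<le> length (bs k) \<Longrightarrow> \<bar>rs k ! i\<bar> \<le> L"
  shows "\<bar>f k x - f k y\<bar> \<le> L * \<bar>x - y\<bar>"
  using pl_map.lipschitz[OF CPLIFS_pl_map[OF assms(1,2)]] assms(3) by blast

lemma CPLIFS_image_interval:
  assumes F: "is_CPLIFS m f bs rs" and k: "k < m" and pq: "p < q"
    and c: "0 < c" "\<And>i. i \<le> length (bs k) \<Longrightarrow> c \<le> \<bar>rs k ! i\<bar>"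
    and L: "\<And>i. i \<le> length (bs k) \<Longrightarrow> \<bar>rs k ! i\<bar> \<le> L"
  obtains p' q' where "p' < q'" "f k ` {p..q} = {p'..q'}"
    "c / 2 ^ length (bs k) * (q - p) \<le> q' - p'" "q' - p' \<le> L * (q - p)"
proof -
  obtain x y where xy: "x \<in> {p..q}" "y \<in> {p..q}" "c * (q - p) / 2 ^ length (bs k) \<le> \<bar>f k x - f k y\<bar>"
    using pl_map.expansion[OF CPLIFS_pl_map[OF F k] c(2), of p q] c(1) pq by auto
  have "0 < c * (q - p) / 2 ^ length (bs k)" using c pq by simp
  then have "f k x \<noteq> f k y" using xy(3) by auto
  then obtain p' q' where 1: "p' < q'" "f k ` {p..q} = {p'..q'}"
    using image_interval[OF pq CPLIFS_D(3)[OF F k] xy(1,2)] by blast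
  have "0 \<le> L" using L[of 0] by linarith
  then have "q' - p' \<le> L * (q - p)"
    using ilen_image_le[OF pq 1, of L] CPLIFS_lipschitz[OF F k L] 1 by simp
  moreover have "c / 2 ^ length (bs k) * (q - p) \<le> q' - p'"
    using ilen_image_ge[OF 1 xy(1,2)] xy(3) 1 by simp
  ultimately show ?thesis using that 1 by blast
qed

lemma CPLIFS_image_affine:
  assumes F: "is_CPLIFS m f bs rs" and k: "k < m" and pq: "p < q"
    and i: "i \<le> length (bs k)" "{p..q} \<subseteq> piece (bs k) i"
  shows "ilen (f k ` {p..q}) = \<bar>rs k ! i\<bar> * (q - p)"
proof -
  have eq: "f k x - f k y = rs k ! i * (x - y)" if "x \<in> {p..q}" "y \<in> {p..q}" for x y
    using CPLIFS_affine[OF F k i(1) subsetD[OF i(2)]] that by (simp add: sim_map_def right_diff_distrib)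
  have mem: "p \<in> {p..q}" "q \<in> {p..q}" using pq by auto
  have "f k p \<noteq> f k q" using eq[OF mem] pq CPLIFS_D(5)[OF F k i(1)] by auto
  then obtain p' q' where 1: "p' < q'" "f k ` {p..q} = {p'..q'}"
    using image_interval[OF pq CPLIFS_D(3)[OF F k] mem] by blast
  have "ilen (f k ` {p..q}) \<le> \<bar>rs k ! i\<bar> * (q - p)"
    by (rule ilen_image_le[OF pq 1]) (simp_all add: eq abs_mult)
  moreover have "\<bar>rs k ! i\<bar> * (q - p) \<le> ilen (f k ` {p..q})"
    using ilen_image_ge[OF 1 mem] eq[OF mem] pq by (simp add: abs_mult)
  ultimately show ?thesis by simp
qed

section \<open>Compositions of the maps along words\<close>

lemma comp_word_simps [simp]:
  "comp_word f [] = id" "comp_word f (k # w) x = f k (comp_word f w x)"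
  by (simp_all add: comp_word_def)

lemma comp_word_append: "comp_word f (u @ w) x = comp_word f u (comp_word f w x)"
  by (induction u) auto

lemma comp_word_Cons_image: "comp_word f (k # w) ` S = f k ` (comp_word f w ` S)"
  by (simp add: image_image)

lemma cylinder_Cons: "cylinder m f (k # w) = f k ` cylinder m f w"
  unfolding cylinder_def by (rule comp_word_Cons_image)

text \<open>The errors form a geometric series with sum \<open>\<delta> / (1 - L)\<close>. Both maps
  are compared at the point of the \<open>g\<close>-orbit, so only the contraction of
  \<open>f\<close> is needed and the bound is uniform in \<open>g\<close>. With \<open>g = f\<close>
  and \<open>\<delta> = 0\<close> it bounds the size of cylinders.\<close>

lemma comp_word_perturb:
  assumes lip: "\<And>k x y. k < m \<Longrightarrow> \<bar>f k x - f k y\<bar> \<le> L * \<bar>x - y\<bar>"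
    and L: "0 \<le> L" "L < 1" and near: "\<And>k x. k < m \<Longrightarrow> \<bar>f k x - g k x\<bar> \<le> \<delta>"
    and w: "set w \<subseteq> {..<m}" and \<delta>: "0 \<le> \<delta>"
  shows "\<bar>comp_word g w y - comp_word f w x\<bar> \<le> L ^ length w * \<bar>y - x\<bar> + \<delta> / (1 - L)"
  using w
proof (induction w)
  case Nil
  then show ?case using L \<delta> by simp
next
  case (Cons k w)
  let ?y = "comp_word g w y" and ?x = "comp_word f w x"
  have "\<bar>g k ?y - f k ?x\<bar> \<le> \<bar>f k ?y - g k ?y\<bar> + \<bar>f k ?y - f k ?x\<bar>" by linarith
  also have "\<dots> \<le> \<delta> + L * \<bar>?y - ?x\<bar>" using near[of k ?y] lip[of k ?y ?x] Cons.prems by simp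
  also have "\<dots> \<le> \<delta> + L * (L ^ length w * \<bar>y - x\<bar> + \<delta> / (1 - L))"
    using Cons L(1) by (simp add: mult_left_mono)
  also have "\<dots> = L ^ length (k # w) * \<bar>y - x\<bar> + \<delta> / (1 - L)"
    using L by (simp add: field_simps)
  finally show ?case by simp
qed

lemma CPLIFS_word_interval:
  assumes F: "is_CPLIFS m f bs rs" and pq: "p < q"
    and c: "0 < c" "\<And>k i. k < m \<Longrightarrow> i \<le> length (bs k) \<Longrightarrow> c \<le> \<bar>rs k ! i\<bar>"
    and L: "\<And>k i. k < m \<Longrightarrow> i \<le> length (bs k) \<Longrightarrow> \<bar>rs k ! i\<bar> \<le> L"
    and l: "\<And>k. k < m \<Longrightarrow> length (bs k) \<le> l" and w: "set w \<subseteq> {..<m}"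
  shows "\<exists>p' q'. p' < q' \<and> comp_word f w ` {p..q} = {p'..q'} \<and>
    (c / 2 ^ l) ^ length w * (q - p) \<le> q' - p' \<and> q' - p' \<le> L ^ length w * (q - p)"
  using w
proof (induction w)
  case Nil
  then show ?case using pq by auto
next
  case (Cons k w)
  then obtain p1 q1 where 1: "p1 < q1" "comp_word f w ` {p..q} = {p1..q1}"
    "(c / 2 ^ l) ^ length w * (q - p) \<le> q1 - p1" "q1 - p1 \<le> L ^ length w * (q - p)" by auto
  have k: "k < m" using Cons.prems by simp
  obtain p2 q2 where 2: "p2 < q2" "f k ` {p1..q1} = {p2..q2}"
    "c / 2 ^ length (bs k) * (q1 - p1) \<le> q2 - p2" "q2 - p2 \<le> L * (q1 - p1)"
    using CPLIFS_image_interval[OF F k 1(1) c(1) c(2)[OF k] L[OF k]] by blast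
  have "0 \<le> L" using L[OF k, of 0] by linarith
  then have "q2 - p2 \<le> L ^ length (k # w) * (q - p)"
    using 2(4) mult_left_mono[OF 1(4), of L] by (simp add: mult.assoc)
  moreover have "c / 2 ^ l \<le> c / 2 ^ length (bs k)"
    using l[OF k] c(1) by (intro divide_left_mono) auto
  then have "c / 2 ^ l * ((c / 2 ^ l) ^ length w * (q - p)) \<le> c / 2 ^ length (bs k) * (q1 - p1)"
    using 1 c(1) pq by (intro mult_mono) auto
  then have "(c / 2 ^ l) ^ length (k # w) * (q - p) \<le> q2 - p2" using 2(3) by (simp add: mult.assoc)
  ultimately show ?case using 1 2 unfolding comp_word_Cons_image by auto
qed

text \<open>Without a common fixed point, every invariant compact interval contains the fixed point
  of each map, by Banach's theorem inside that interval. Two different fixed points make the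
  intersection nondegenerate, so cylinders have positive length.\<close>

lemma CPLIFS_base_int:
  assumes F: "is_CPLIFS m f bs rs"
  obtains p q where "p < q" "base_int m f = {p..q}"
proof (cases "\<exists>\<phi>. \<forall>k<m. f k \<phi> = \<phi>")
  case True
  then show ?thesis using that unfolding base_int_def Let_def by (simp only: if_True) force
next
  case False
  define FF where "FF = {{a..b} | a b. a \<le> b \<and> (\<forall>k<m. f k ` {a..b} \<subseteq> {a..b})}"
  have b: "base_int m f = \<Inter>FF" unfolding base_int_def FF_def by (rule if_not_P[OF False])
  obtain c L where cL: "0 < c" "0 < L" "L < 1"
    "\<And>k i. k < m \<Longrightarrow> i \<le> length (bs k) \<Longrightarrow> c \<le> \<bar>rs k ! i\<bar>"
    "\<And>k i. k < m \<Longrightarrow> i \<le> length (bs k) \<Longrightarrow> \<bar>rs k ! i\<bar> \<le> L"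
    using CPLIFS_slope_bounds[OF F] by blast
  have lip: "\<bar>f k x - f k y\<bar> \<le> L * \<bar>x - y\<bar>" if "k < m" for k x y
    using CPLIFS_lipschitz[OF F that cL(5)[OF that]] .
  have uniq: "x = y" if "k < m" "f k x = x" "f k y = y" for k x y
  proof (rule ccontr)
    assume "x \<noteq> y"
    then have "L * \<bar>x - y\<bar> < 1 * \<bar>x - y\<bar>" using cL by (intro mult_strict_right_mono) auto
    then show False using lip[OF that(1), of x y] that by simp
  qed
  have fix_in: "\<exists>x\<in>S. f k x = x" if "k < m" "S \<noteq> {}" "closed S" "f k ` S \<subseteq> S" for k S
  proof -
    have "\<exists>!x\<in>S. f k x = x"
      using that cL lip by (intro Banach_fix[of S L "f k"])
        (auto simp: dist_real_def complete_eq_closed)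
    then show ?thesis by blast
  qed
  have "\<exists>x. f k x = x" if "k < m" for k using fix_in[OF that, of UNIV] by auto
  then obtain z where z: "\<And>k. k < m \<Longrightarrow> f k (z k) = z k" by metis
  have zin: "z k \<in> \<Inter>FF" if "k < m" for k
  proof
    fix S assume "S \<in> FF"
    then have "S \<noteq> {}" "closed S" "f k ` S \<subseteq> S" using that by (auto simp: FF_def)
    then show "z k \<in> S" using fix_in[OF that] uniq[OF that] z[OF that] by metis
  qed
  have ne: "FF \<noteq> {}"
  proof -
    \<comment> \<open>Chosen so that \<open>\<bar>f k 0\<bar> + L * R \<le> R\<close>, which makes
      the interval from \<open>-R\<close> to \<open>R\<close> invariant.\<close>
    define R where "R = (\<Sum>k<m. \<bar>f k 0\<bar>) / (1 - L)"
    have R0: "0 \<le> R" using cL by (auto simp: R_def intro!: divide_nonneg_nonneg sum_nonneg)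
    have "\<bar>f k x\<bar> \<le> R" if "k < m" "\<bar>x\<bar> \<le> R" for k x
    proof -
      have "\<bar>f k 0\<bar> \<le> (\<Sum>k<m. \<bar>f k 0\<bar>)" using that by (intro member_le_sum) auto
      also have "\<dots> = R * (1 - L)" using cL by (simp add: R_def)
      finally have "\<bar>f k 0\<bar> \<le> R - L * R" by (simp add: algebra_simps)
      moreover have "\<bar>f k x - f k 0\<bar> \<le> L * R"
        using order_trans[OF lip[OF that(1), of x 0] mult_left_mono[of "\<bar>x - 0\<bar>" R L]] that(2) cL(2) by simp
      ultimately show ?thesis by linarith
    qed
    then have "{-R..R} \<in> FF" using R0 unfolding FF_def
      by (auto intro!: exI[of _ "-R"] exI[of _ R] simp: abs_le_iff minus_le_iff)
    then show ?thesis by blast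
  qed
  have FF: "closed S" "bounded S" "convex S" if "S \<in> FF" for S using that by (auto simp: FF_def)
  have "bounded (\<Inter>FF)" using ne FF(2) by (meson Inter_lower bounded_subset ex_in_conv)
  then have "compact (\<Inter>FF)" "connected (\<Inter>FF)"
    using FF by (auto simp: compact_eq_bounded_closed intro!: convex_connected convex_Inter)
  then obtain p q where pq: "\<Inter>FF = {p..q}" using connected_compact_interval_1 by blast
  have "\<exists>k<m. z k \<noteq> z 0" using False z by metis
  then have "p < q" using zin[of 0] zin CPLIFS_D(1)[OF F] unfolding pq
    by (metis (no_types, opaque_lifting) atLeastAtMost_iff less_le_trans nle_le not_less order_trans zero_less_numeral)
  then show ?thesis using that pq b by simp
qed

section \<open>Pressure of a family of positive weights\<close>

definition pressure :: "nat \<Rightarrow> (nat list \<Rightarrow> real) \<Rightarrow> real \<Rightarrow> ereal" where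
  "pressure m a s = limsup (\<lambda>n. ereal (ln (\<Sum>w\<in>words m n. a w powr s) / real n))"

lemma nat_pressure_eq: "nat_pressure m f = pressure m (\<lambda>w. ilen (cylinder m f w))"
  by (rule ext) (simp add: nat_pressure_def pressure_def)

lemma words_eq: "words m n = {w. set w \<subseteq> {..<m} \<and> length w = n}"
  by (auto simp: words_def)

lemma finite_words: "finite (words m n)"
  unfolding words_eq by (rule finite_lists_length_eq) simp

lemma card_words: "card (words m n) = m ^ n"
  unfolding words_eq by (subst card_lists_length_eq) auto

text \<open>With two weight families and two exponents, one estimate serves both purposes: equal
  weights give decay and growth of the pressure in the exponent, equal exponents compare two
  systems.\<close>

lemma pressure_compare:
  assumes m: "0 < m"
    and a: "\<And>w. set w \<subseteq> {..<m} \<Longrightarrow> 0 < a w" and b: "\<And>w. set w \<subseteq> {..<m} \<Longrightarrow> 0 < b w"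
    and cmp: "\<And>w. set w \<subseteq> {..<m} \<Longrightarrow> s * ln (a w) \<le> t * ln (b w) + K + \<eta> * real (length w)"
  shows "pressure m a s \<le> ereal \<eta> + pressure m b t"
proof -
  define A where "A = (\<lambda>n. \<Sum>w\<in>words m n. a w powr s)"
  define B where "B = (\<lambda>n. \<Sum>w\<in>words m n. b w powr t)"
  have ne: "words m n \<noteq> {}" for n using card_words[of m n] m by force
  have pos: "0 < A n" "0 < B n" for n
    unfolding A_def B_def using a b ne finite_words by (auto intro!: sum_pos simp: words_def) (metis less_irrefl)+
  have AB: "A n \<le> exp (K + \<eta> * n) * B n" for n
    unfolding A_def B_def sum_distrib_left
  proof (rule sum_mono)
    fix w assume "w \<in> words m n"
    then have w: "set w \<subseteq> {..<m}" "length w = n" by (auto simp: words_def)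
    have "a w powr s = exp (s * ln (a w))" using a[OF w(1)] by (simp add: powr_def)
    also have "\<dots> \<le> exp (t * ln (b w) + K + \<eta> * n)" using cmp[OF w(1)] w(2) by simp
    also have "\<dots> = exp (K + \<eta> * n) * b w powr t" using b[OF w(1)] by (simp add: powr_def exp_add)
    finally show "a w powr s \<le> exp (K + \<eta> * n) * b w powr t" .
  qed
  \<comment> \<open>At \<open>n = 0\<close> the quotients are 0 and the claim would read
    \<open>0 \<le> \<eta>\<close>, but negative rates are needed for the decay.\<close>
  have "ln (A n) / n \<le> (K / n + \<eta>) + ln (B n) / n" if "n > 0" for n
  proof -
    have "ln (A n) \<le> ln (exp (K + \<eta> * n) * B n)" using AB pos by (subst ln_le_cancel_iff) auto
    also have "\<dots> = K + \<eta> * n + ln (B n)" using pos[of n] by (subst ln_mult) auto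
    finally have "ln (A n) / n \<le> (K + \<eta> * n + ln (B n)) / n" by (rule divide_right_mono) simp
    also have "\<dots> = (K / n + \<eta>) + ln (B n) / n" using that by (simp add: field_simps)
    finally show ?thesis .
  qed
  then have "pressure m a s \<le> limsup (\<lambda>n. ereal (K / n + \<eta>) + ereal (ln (B n) / n))"
    unfolding pressure_def A_def
    by (intro Limsup_mono) (auto simp: eventually_sequentially intro!: exI[of _ 1])
  also have "\<dots> = ereal \<eta> + limsup (\<lambda>n. ereal (ln (B n) / n))"
  proof (rule ereal_limsup_lim_add)
    have "(\<lambda>n. K / real n + \<eta>) \<longlonglongrightarrow> 0 + \<eta>"
      by (intro tendsto_add tendsto_const lim_const_over_n)
    then show "(\<lambda>n. ereal (K / real n + \<eta>)) \<longlonglongrightarrow> ereal \<eta>" by simp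
  qed simp
  finally show ?thesis by (simp add: pressure_def B_def)
qed

lemma pressure_decay:
  assumes m: "0 < m" and a: "\<And>w. set w \<subseteq> {..<m} \<Longrightarrow> 0 < a w"
    and up: "\<And>w. set w \<subseteq> {..<m} \<Longrightarrow> ln (a w) \<le> K + \<theta> * real (length w)" and "s \<le> t"
  shows "pressure m a t \<le> ereal ((t - s) * \<theta>) + pressure m a s"
proof (rule pressure_compare[OF m a a])
  fix w assume "set w \<subseteq> {..<m}"
  then have "(t - s) * ln (a w) \<le> (t - s) * (K + \<theta> * real (length w))"
    using up \<open>s \<le> t\<close> by (intro mult_left_mono) auto
  then show "t * ln (a w) \<le> s * ln (a w) + (t - s) * K + (t - s) * \<theta> * real (length w)"
    by (simp add: algebra_simps)
qed

lemma pressure_growth: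
  assumes m: "0 < m" and a: "\<And>w. set w \<subseteq> {..<m} \<Longrightarrow> 0 < a w"
    and low: "\<And>w. set w \<subseteq> {..<m} \<Longrightarrow> K + \<mu> * real (length w) \<le> ln (a w)" and "s \<le> t"
  shows "pressure m a s \<le> ereal ((t - s) * - \<mu>) + pressure m a t"
proof (rule pressure_compare[OF m a a])
  fix w assume "set w \<subseteq> {..<m}"
  then have "(t - s) * (K + \<mu> * real (length w)) \<le> (t - s) * ln (a w)"
    using low \<open>s \<le> t\<close> by (intro mult_left_mono) auto
  then show "s * ln (a w) \<le> t * ln (a w) + (t - s) * - K + (t - s) * - \<mu> * real (length w)"
    by (simp add: algebra_simps)
qed

lemma pressure_0:
  assumes m: "0 < m" and a: "\<And>w. set w \<subseteq> {..<m} \<Longrightarrow> 0 < a w"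
  shows "pressure m a 0 = ereal (ln m)"
proof -
  have "(\<Sum>w\<in>words m n. a w powr 0) = real m ^ n" for n
  proof -
    \<comment> \<open>Positivity of the weights matters here, since
      \<open>0 powr 0 = 0\<close>.\<close>
    have "(\<Sum>w\<in>words m n. a w powr 0) = (\<Sum>w\<in>words m n. 1)"
      using a by (intro sum.cong) (fastforce simp: words_def)+
    then show ?thesis by (simp add: card_words)
  qed
  then have "pressure m a 0 = limsup (\<lambda>n. ereal (ln (real m ^ n) / real n))" by (simp add: pressure_def)
  also have "\<dots> = limsup (\<lambda>n. ereal (ln m))"
    using m by (intro Limsup_eq) (auto simp: eventually_sequentially ln_realpow intro!: exI[of _ 1])
  finally show ?thesis by (simp add: Limsup_const)
qed

text \<open>Decay and growth at linear rates make the pressure finite, Lipschitz and strictly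
  decreasing on nonnegative exponents; the intermediate value theorem then gives the zero.\<close>

lemma pressure_ex1_zero:
  assumes m: "2 \<le> m" and a: "\<And>w. set w \<subseteq> {..<m} \<Longrightarrow> 0 < a w"
    and up: "\<And>w. set w \<subseteq> {..<m} \<Longrightarrow> ln (a w) \<le> K + \<theta> * real (length w)" and \<theta>: "\<theta> < 0"
    and low: "\<And>w. set w \<subseteq> {..<m} \<Longrightarrow> K' + \<mu> * real (length w) \<le> ln (a w)"
  shows "\<exists>!s. 0 \<le> s \<and> pressure m a s = 0"
proof -
  have m0: "0 < m" using m by simp
  have decay: "pressure m a t \<le> ereal ((t - s) * \<theta>) + pressure m a s"
    and growth: "pressure m a s \<le> ereal ((t - s) * - \<mu>) + pressure m a t" if "s \<le> t" for s t
    by (rule pressure_decay[OF m0 a up that] pressure_growth[OF m0 a low that], assumption+)+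
  have p0: "pressure m a 0 = ereal (ln m)" by (rule pressure_0[OF m0 a])
  define \<phi> where "\<phi> = (\<lambda>s. real_of_ereal (pressure m a s))"
  have fin: "pressure m a s = ereal (\<phi> s)" if "0 \<le> s" for s
  proof -
    have "pressure m a s \<le> ereal (s * \<theta> + ln m)" "ereal (ln m) \<le> ereal (s * - \<mu>) + pressure m a s"
      using decay[of 0 s] growth[of 0 s] that by (simp_all add: p0)
    then show ?thesis unfolding \<phi>_def by (cases "pressure m a s") auto
  qed
  have dec: "\<phi> t \<le> \<phi> s + (t - s) * \<theta>" and gro: "\<phi> s \<le> \<phi> t - (t - s) * \<mu>" if "0 \<le> s" "s \<le> t" for s t
    using decay[of s t] growth[of s t] that fin[of s] fin[of t] by simp_all
  \<comment> \<open>The point where the upper bound \<open>ln m + T * \<theta>\<close> of the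
    pressure reaches 0.\<close>
  define T where "T = ln m / - \<theta>"
  have T: "0 \<le> T" unfolding T_def using m \<theta> by (intro divide_nonneg_pos) auto
  have "\<phi> 0 = ln m" using p0 by (simp add: \<phi>_def)
  then have ends: "\<phi> T \<le> 0" "0 \<le> \<phi> 0" using dec[of 0 T] T \<theta> m by (simp_all add: T_def)
  have "(max \<bar>\<theta>\<bar> \<bar>\<mu>\<bar>)-lipschitz_on {0..T} \<phi>"
  proof (rule lipschitz_onI)
    have *: "\<bar>\<phi> s - \<phi> t\<bar> \<le> max \<bar>\<theta>\<bar> \<bar>\<mu>\<bar> * (t - s)" if "0 \<le> s" "s \<le> t" for s t
    proof -
      have "(t - s) * \<theta> \<le> 0" using \<theta> that by (simp add: mult_nonneg_nonpos)
      moreover have "(t - s) * - \<mu> \<le> (t - s) * max \<bar>\<theta>\<bar> \<bar>\<mu>\<bar>" using that by (intro mult_left_mono) auto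
      moreover have "0 \<le> (t - s) * max \<bar>\<theta>\<bar> \<bar>\<mu>\<bar>" using that by simp
      ultimately show ?thesis using dec[OF that] gro[OF that] by (simp add: mult.commute)
    qed
    fix s t assume "s \<in> {0..T}" "t \<in> {0..T}"
    then show "dist (\<phi> s) (\<phi> t) \<le> max \<bar>\<theta>\<bar> \<bar>\<mu>\<bar> * dist s t"
      using *[of s t] *[of t s] unfolding dist_real_def by (cases "s \<le> t") (simp_all add: abs_minus_commute)
  qed simp
  then have "continuous_on {0..T} \<phi>" by (rule lipschitz_on_continuous_on)
  then obtain s where s: "0 \<le> s" "\<phi> s = 0" using IVT2'[OF ends T] by blast
  have strict: "\<phi> t < \<phi> s" if "0 \<le> s" "s < t" for s t
    using dec[of s t] mult_pos_neg[of "t - s" \<theta>] \<theta> that by linarith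
  have uniq: "t = s" if "0 \<le> t" "\<phi> t = 0" for t
    using strict[of s t] strict[of t s] s that by (cases s t rule: linorder_cases) linarith+
  show ?thesis
  proof (intro ex1I[of _ s])
    show "0 \<le> s \<and> pressure m a s = 0" using fin[OF s(1)] s by simp
    show "t = s" if "0 \<le> t \<and> pressure m a t = 0" for t
      using uniq[of t] fin[of t] that by simp
  qed
qed

section \<open>Consequences of the absence of exact overlaps\<close>

lemma sim_word_simps [simp]:
  "sim_word f bs rs [] = id"
  "sim_word f bs rs (p # W) x = sim_map f bs rs (fst p) (snd p) (sim_word f bs rs W x)"
  by (auto simp: sim_word_def split: prod.splits)

lemma sim_word_append: "sim_word f bs rs (V @ W) x = sim_word f bs rs V (sim_word f bs rs W x)"
  by (induction V) auto

lemma sim_word_affine: "\<exists>A. \<forall>x y. sim_word f bs rs W x - sim_word f bs rs W y = A * (x - y)"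
proof (induction W)
  case Nil
  show ?case by (auto intro: exI[of _ 1])
next
  case (Cons p W)
  then obtain A where A: "\<And>x y. sim_word f bs rs W x - sim_word f bs rs W y = A * (x - y)" by blast
  have "sim_word f bs rs (p # W) x - sim_word f bs rs (p # W) y = (rs (fst p) ! snd p * A) * (x - y)" for x y
    using A[of x y] by (simp add: sim_map_def right_diff_distrib[symmetric] mult.assoc)
  then show ?case by blast
qed

text \<open>Along the orbit of one point, each map may be replaced by the similarity of a piece
  containing the current point; hence \<open>W\<close> depends on \<open>x\<close>.\<close>

lemma comp_word_eq_sim_word:
  assumes F: "is_CPLIFS m f bs rs" and "set u \<subseteq> {..<m}"
  shows "\<exists>W. length W = length u \<and> set W \<subseteq> sim_alphabet m bs \<and> sim_word f bs rs W x = comp_word f u x"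
  using assms(2)
proof (induction u)
  case Nil
  then show ?case by simp
next
  case (Cons k u)
  then obtain W where W: "length W = length u" "set W \<subseteq> sim_alphabet m bs"
    "sim_word f bs rs W x = comp_word f u x" by auto
  obtain i where i: "i \<le> length (bs k)" "comp_word f u x \<in> piece (bs k) i" using ex_piece by blast
  have "k < m" using Cons.prems by simp
  then have "f k (comp_word f u x) = sim_map f bs rs k i (comp_word f u x)"
    using CPLIFS_affine[OF F _ i] by simp
  then show ?case using W i(1) \<open>k < m\<close> by (intro exI[of _ "(k, i) # W"]) (auto simp: sim_alphabet_def)
qed

text \<open>If a breaking point returned to itself, then the two branches meeting there would give two
  similarities with a common fixed point; these commute, which is an exact overlap.\<close>

lemma breakpoint_no_return:
  assumes F: "is_CPLIFS m f bs rs" and N: "no_exact_overlap m f bs rs"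
    and k: "k < m" and i: "i < length (bs k)" and u: "set u \<subseteq> {..<m}"
  shows "comp_word f u (f k (bs k ! i)) \<noteq> bs k ! i"
proof
  let ?b = "bs k ! i" and ?S = "sim_word f bs rs"
  assume ret: "comp_word f u (f k ?b) = ?b"
  obtain W where W: "set W \<subseteq> sim_alphabet m bs" "?S W (f k ?b) = ?b"
    using comp_word_eq_sim_word[OF F u, of "f k ?b"] ret by auto
  \<comment> \<open>\<open>W\<close> depends only on the point \<open>f k ?b\<close>, where both
    branches agree, so the two words differ in their last letter alone.\<close>
  define V where "V = (\<lambda>j. W @ [(k, j)])"
  have lt: "bs k ! j < bs k ! j'" if "j < j'" "j' < length (bs k)" for j j'
    using CPLIFS_D(2)[OF F k] that by (simp add: sorted_wrt_iff_nth_less)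
  have "i = 0 \<or> bs k ! (i - 1) \<le> ?b" "Suc i = length (bs k) \<or> ?b \<le> bs k ! Suc i"
    using lt[of "i - 1" i] lt[of i "Suc i"] i by linarith+
  then have "?b \<in> piece (bs k) i" "?b \<in> piece (bs k) (Suc i)" by (auto simp: piece_def)
  then have fixed: "?S (V j) ?b = ?b" if "j = i \<or> j = Suc i" for j
    using that W(2) CPLIFS_affine[OF F k, of i ?b] CPLIFS_affine[OF F k, of "Suc i" ?b] i
    by (auto simp: V_def sim_word_append)
  obtain A where A: "\<And>x y. ?S (V i) x - ?S (V i) y = A * (x - y)" using sim_word_affine by metis
  obtain B where B: "\<And>x y. ?S (V (Suc i)) x - ?S (V (Suc i)) y = B * (x - y)" using sim_word_affine by metis
  have VA: "?S (V i) x = ?b + A * (x - ?b)" for x using A[of x ?b] fixed[of i] by simp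
  have VB: "?S (V (Suc i)) x = ?b + B * (x - ?b)" for x using B[of x ?b] fixed[of "Suc i"] by simp
  have "?S (V i @ V (Suc i)) = ?S (V (Suc i) @ V i)"
    by (rule ext) (simp add: sim_word_append VA VB)
  moreover have "set (V i) \<subseteq> sim_alphabet m bs" "set (V (Suc i)) \<subseteq> sim_alphabet m bs"
    using W(1) k i by (auto simp: V_def sim_alphabet_def)
  moreover have "length (V i @ V (Suc i)) \<ge> 1" "length (V i @ V (Suc i)) = length (V (Suc i) @ V i)"
    by (auto simp: V_def)
  ultimately have "V i @ V (Suc i) = V (Suc i) @ V i"
    using N unfolding no_exact_overlap_def by (metis set_append Un_least)
  then show False by (simp add: V_def)
qed

lemma finite_pos_lower_bound:
  fixes V :: "real set"
  assumes "finite V" "\<And>v. v \<in> V \<Longrightarrow> 0 < v"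
  shows "\<exists>d>0. \<forall>v\<in>V. d < v"
proof (intro exI conjI ballI)
  \<comment> \<open>Inserting 1 covers empty \<open>V\<close>; halving makes the bound
    strict.\<close>
  show "0 < Min (insert 1 V) / 2" using assms by auto
  fix v assume "v \<in> V"
  then have "Min (insert 1 V) \<le> v" "0 < v" using assms by auto
  moreover have "0 < Min (insert 1 V)" using assms by auto
  ultimately show "Min (insert 1 V) / 2 < v" by linarith
qed

section \<open>Counting passages of orbits near breaking points\<close>

definition breakpoints :: "nat \<Rightarrow> (nat \<Rightarrow> real list) \<Rightarrow> (nat \<times> nat) set" where
  "breakpoints m bs = {(k, i). k < m \<and> i < length (bs k)}"

lemma finite_breakpoints: "finite (breakpoints m bs)"
  by (rule finite_subset[OF _ finite_sim_alphabet[of m bs]]) (auto simp: breakpoints_def sim_alphabet_def)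

text \<open>Only finitely many words have length at most \<open>N\<close>, so nonreturn becomes a
  uniform distance. That distance depends on \<open>N\<close>.\<close>

lemma breakpoint_separation:
  assumes F: "is_CPLIFS m f bs rs" and N: "no_exact_overlap m f bs rs"
  obtains d where "0 < d" "\<And>u k i. set u \<subseteq> {..<m} \<Longrightarrow> length u \<le> N \<Longrightarrow> k < m \<Longrightarrow> i < length (bs k) \<Longrightarrow>
    d < \<bar>comp_word f u (f k (bs k ! i)) - bs k ! i\<bar>"
proof -
  define V where "V = (\<lambda>(u, k, i). \<bar>comp_word f u (f k (bs k ! i)) - bs k ! i\<bar>) `
    ({u. set u \<subseteq> {..<m} \<and> length u \<le> N} \<times> breakpoints m bs)"
  have fin: "finite V" unfolding V_def
    by (intro finite_imageI finite_cartesian_product finite_lists_length_le finite_breakpoints) simp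
  have pos: "0 < v" if "v \<in> V" for v
    using that breakpoint_no_return[OF assms] by (auto simp: V_def breakpoints_def)
  obtain d where d: "0 < d" "\<forall>v\<in>V. d < v" using finite_pos_lower_bound[OF fin pos] by blast
  show ?thesis
  proof (rule that[OF d(1)])
    fix u k i assume "set u \<subseteq> {..<m}" "length u \<le> N" "k < m" "i < length (bs k)"
    then have "\<bar>comp_word f u (f k (bs k ! i)) - bs k ! i\<bar> \<in> V"
      unfolding V_def by (intro image_eqI[of _ _ "(u, k, i)"]) (auto simp: breakpoints_def)
    then show "d < \<bar>comp_word f u (f k (bs k ! i)) - bs k ! i\<bar>" using d(2) by blast
  qed
qed

text \<open>Words act from the right, so the head \<open>k\<close> is applied to the point reached
  by the tail. Only the breaking points of the map about to be applied count, since only these can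
  bend the current cylinder.\<close>

fun hits :: "(nat \<Rightarrow> real \<Rightarrow> real) \<Rightarrow> (nat \<Rightarrow> real list) \<Rightarrow> real \<Rightarrow> real \<Rightarrow> nat list \<Rightarrow> nat" where
  "hits f bs d y [] = 0"
| "hits f bs d y (k # w) = hits f bs d y w +
     (if \<exists>i<length (bs k). \<bar>comp_word f w y - bs k ! i\<bar> \<le> d then 1 else 0)"

lemma hits_append: "hits f bs d y (u @ w) = hits f bs d (comp_word f w y) u + hits f bs d y w"
  by (induction u) (auto simp: comp_word_append)

lemma comp_word_nonexpansive:
  assumes "\<And>k x y. k < m \<Longrightarrow> \<bar>f k x - f k y\<bar> \<le> \<bar>x - y\<bar>" "set u \<subseteq> {..<m}"
  shows "\<bar>comp_word f u x - comp_word f u y\<bar> \<le> \<bar>x - y\<bar>"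
  using assms(2) by (induction u) (auto intro: order_trans[OF assms(1)])

lemma hits_short_word:
  assumes lip: "\<And>k x y. k < m \<Longrightarrow> \<bar>f k x - f k y\<bar> \<le> \<bar>x - y\<bar>"
    and sep: "\<And>u k i. set u \<subseteq> {..<m} \<Longrightarrow> length u \<le> N \<Longrightarrow> k < m \<Longrightarrow> i < length (bs k) \<Longrightarrow>
      2 * d < \<bar>comp_word f u (f k (bs k ! i)) - bs k ! i\<bar>"
    and w: "set w \<subseteq> {..<m}" "length w \<le> N"
  shows "hits f bs d y w \<le> card (breakpoints m bs)"
proof -
  \<comment> \<open>The breaking points already used; every hit enlarges this set.\<close>
  define H where "H = (\<lambda>w. {(k, i). k < m \<and> i < length (bs k) \<and>
    (\<exists>u v. w = u @ k # v \<and> \<bar>comp_word f v y - bs k ! i\<bar> \<le> d)})"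
  have sub: "H w \<subseteq> breakpoints m bs" for w by (auto simp: H_def breakpoints_def)
  then have fin: "finite (H w)" for w using finite_breakpoints finite_subset by blast
  have "hits f bs d y w \<le> card (H w)" using w
  proof (induction w)
    case (Cons k w)
    then have IH: "hits f bs d y w \<le> card (H w)" by auto
    have mono: "H w \<subseteq> H (k # w)" unfolding H_def by (auto intro: Cons_eq_appendI)
    show ?case
    proof (cases "\<exists>i<length (bs k). \<bar>comp_word f w y - bs k ! i\<bar> \<le> d")
      case True
      then obtain i where i: "i < length (bs k)" "\<bar>comp_word f w y - bs k ! i\<bar> \<le> d" by blast
      let ?b = "bs k ! i"
      have k: "k < m" using Cons.prems by simp
      have "(k, i) \<notin> H w"
      proof
        assume "(k, i) \<in> H w"
        then obtain u v where uv: "w = u @ k # v" "\<bar>comp_word f v y - ?b\<bar> \<le> d" by (auto simp: H_def)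
        have u: "set u \<subseteq> {..<m}" "length u \<le> N" using Cons.prems uv(1) by auto
        have "\<bar>comp_word f w y - comp_word f u (f k ?b)\<bar> \<le> \<bar>f k (comp_word f v y) - f k ?b\<bar>"
          using comp_word_nonexpansive[OF lip u(1)] by (simp add: uv(1) comp_word_append)
        also have "\<dots> \<le> d" using lip[OF k, of "comp_word f v y" ?b] uv(2) by linarith
        finally show False using sep[OF u k i(1)] i(2) by linarith
      qed
      moreover have "(k, i) \<in> H (k # w)" using i k by (auto simp: H_def)
      ultimately have "card (H w) < card (H (k # w))" using mono by (intro psubset_card_mono fin) auto
      then show ?thesis using IH True by simp
    next
      case False
      then show ?thesis using IH card_mono[OF fin mono] by auto
    qed
  qed simp
  also have "\<dots> \<le> card (breakpoints m bs)" by (rule card_mono[OF finite_breakpoints sub])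
  finally show ?thesis .
qed

text \<open>Cut the word into blocks of length \<open>N\<close>; the \<open>+ 1\<close> pays for the
  incomplete block.\<close>

lemma hits_le:
  assumes lip: "\<And>k x y. k < m \<Longrightarrow> \<bar>f k x - f k y\<bar> \<le> \<bar>x - y\<bar>"
    and sep: "\<And>u k i. set u \<subseteq> {..<m} \<Longrightarrow> length u \<le> N \<Longrightarrow> k < m \<Longrightarrow> i < length (bs k) \<Longrightarrow>
      2 * d < \<bar>comp_word f u (f k (bs k ! i)) - bs k ! i\<bar>"
    and N: "0 < N" and w: "set w \<subseteq> {..<m}"
  shows "hits f bs d y w \<le> card (breakpoints m bs) * (length w div N + 1)"
  using w
proof (induction "length w" arbitrary: w rule: less_induct)
  case less
  show ?case
  proof (cases "length w < N")
    case True
    then show ?thesis using hits_short_word[OF lip sep less.prems, where y = y] True by simp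
  next
    case False
    let ?B = "card (breakpoints m bs)"
    have t: "set (take N w) \<subseteq> {..<m}" "set (drop N w) \<subseteq> {..<m}"
      using less.prems by (auto dest: in_set_takeD in_set_dropD)
    have "hits f bs d y w = hits f bs d (comp_word f (drop N w) y) (take N w) + hits f bs d y (drop N w)"
      using hits_append[of f bs d y "take N w" "drop N w"] by simp
    also have "\<dots> \<le> ?B + ?B * (length (drop N w) div N + 1)"
      using hits_short_word[OF lip sep t(1)] less.hyps[OF _ t(2)] False N by (intro add_mono) auto
    also have "\<dots> = ?B * (length w div N + 1)"
      using False N by (simp add: le_div_geq[of N "length w"] algebra_simps)
    finally show ?thesis .
  qed
qed

section \<open>Perturbation of breaking points\<close>

lemma piece_perturb:
  assumes i: "i \<le> length b" "{x - 2 * r..x + 2 * r} \<subseteq> piece b i" and r: "0 < r"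
    and len: "length b' = length b" and near: "\<And>j. j < length b \<Longrightarrow> \<bar>b' ! j - b ! j\<bar> < r"
  shows "{x - r..x + r} \<subseteq> piece b' i"
proof
  fix y assume y: "y \<in> {x - r..x + r}"
  have ends: "x - 2 * r \<in> piece b i" "x + 2 * r \<in> piece b i" using i(2) r by auto
  have "b' ! (i - 1) \<le> y" if "i \<noteq> 0"
  proof -
    have "b ! (i - 1) \<le> x - 2 * r" using ends(1) that by (simp add: piece_def)
    moreover have "i - 1 < length b" using i(1) that by linarith
    then have "b' ! (i - 1) - b ! (i - 1) < r" using near[of "i - 1"] by linarith
    ultimately show ?thesis using y by simp
  qed
  moreover have "y \<le> b' ! i" if "i \<noteq> length b"
  proof -
    have "x + 2 * r \<le> b ! i" using ends(2) that by (simp add: piece_def)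
    moreover have "b ! i - b' ! i < r" using near[of i] i(1) that by auto
    ultimately show ?thesis using y by simp
  qed
  ultimately show "y \<in> piece b' i" unfolding piece_def len by blast
qed

text \<open>The second difference gives each breaking point of \<open>h\<close> some breaking point
  of \<open>h'\<close> within \<open>r\<close>. The gap condition makes this assignment strictly
  increasing, and a strictly increasing map of a finite initial segment into itself is the identity,
  so the indices match.\<close>

lemma breakpoints_close:
  assumes h: "pl_map h b \<rho> \<tau>" and h': "pl_map h' b' \<rho>' \<tau>'" and len: "length b' = length b"
    and gap: "\<And>i. Suc i < length b \<Longrightarrow> 2 * r \<le> b ! Suc i - b ! i" and r: "0 < r"
    and jump: "\<And>i. i < length b \<Longrightarrow> 4 * \<delta> < r * \<bar>\<rho> (Suc i) - \<rho> i\<bar>"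
    and near: "\<And>x. \<bar>h x - h' x\<bar> \<le> \<delta>" and i: "i < length b"
  shows "\<bar>b' ! i - b ! i\<bar> < r"
proof -
  interpret h: pl_map h b \<rho> \<tau> by (rule h)
  interpret h': pl_map h' b' \<rho>' \<tau>' by (rule h')
  have "\<exists>j<length b. \<bar>b' ! j - b ! i\<bar> < r" if i: "i < length b" for i
  proof (rule ccontr)
    assume "\<not> ?thesis"
    then have "b' ! j \<le> b ! i - r \<or> b ! i + r \<le> b' ! j" if "j < length b'" for j
      using that len by force
    then obtain l where l: "l \<le> length b'" "{b ! i - r..b ! i + r} \<subseteq> piece b' l"
      using interval_subset_piece[of "b ! i - r" "b ! i + r" b'] r by auto
    have "h' x = \<rho>' l * x + \<tau>' l" if "x \<in> {b ! i - r..b ! i + r}" for x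
      using h'.affine[OF l(1)] l(2) that by blast
    then have "h' (b ! i - r) + h' (b ! i + r) = 2 * h' (b ! i)" using r by (simp add: algebra_simps)
    \<comment> \<open>The gap keeps \<open>b ! i - r\<close> and \<open>b ! i + r\<close> in the two
      pieces that meet at \<open>b ! i\<close>.\<close>
    moreover have "h (b ! i - r) = \<rho> i * (b ! i - r) + \<tau> i" "h (b ! i) = \<rho> i * b ! i + \<tau> i"
      using i r gap[of "i - 1"] by (intro h.affine; cases i; force simp: piece_def)+
    moreover have "h (b ! i + r) = \<rho> (Suc i) * (b ! i + r) + \<tau> (Suc i)"
      "h (b ! i) = \<rho> (Suc i) * b ! i + \<tau> (Suc i)"
      using i r gap[of i] by (intro h.affine; force simp: piece_def)+
    ultimately have eq: "r * (\<rho> (Suc i) - \<rho> i) = (h (b ! i - r) - h' (b ! i - r)) + (h (b ! i + r) - h' (b ! i + r))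
      - 2 * (h (b ! i) - h' (b ! i))" by (simp add: algebra_simps)
    have "\<bar>x + y - 2 * z\<bar> \<le> 4 * \<delta>" if "\<bar>x\<bar> \<le> \<delta>" "\<bar>y\<bar> \<le> \<delta>" "\<bar>z\<bar> \<le> \<delta>" for x y z
      using that by linarith
    from this[OF near[of "b ! i - r"] near[of "b ! i + r"] near[of "b ! i"]]
    have "\<bar>r * (\<rho> (Suc i) - \<rho> i)\<bar> \<le> 4 * \<delta>" unfolding eq .
    then show False using jump[OF i] r by (simp add: abs_mult)
  qed
  then obtain \<sigma> where \<sigma>: "\<And>i. i < length b \<Longrightarrow> \<sigma> i < length b \<and> \<bar>b' ! \<sigma> i - b ! i\<bar> < r" by metis
  have step: "Suc (\<sigma> i) \<le> \<sigma> (Suc i)" if "Suc i < length b" for i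
  proof (rule ccontr)
    assume "\<not> ?thesis"
    then have "\<sigma> (Suc i) \<le> \<sigma> i" by simp
    then have "b' ! \<sigma> (Suc i) \<le> b' ! \<sigma> i"
      using h'.sorted \<sigma>[of i] that len by (cases "\<sigma> (Suc i) = \<sigma> i") (auto simp: sorted_wrt_iff_nth_less less_imp_le)
    then show False using \<sigma>[of i] \<sigma>[of "Suc i"] gap[of i] that by simp linarith
  qed
  have adv: "\<sigma> i + d \<le> \<sigma> (i + d)" if "i + d < length b" for i d
    using that
  proof (induction d)
    case (Suc d)
    then show ?case using step[of "i + d"] by simp
  qed simp
  have "\<sigma> i + (length b - 1 - i) \<le> \<sigma> (length b - 1)" "\<sigma> (length b - 1) < length b"
    using adv[of i "length b - 1 - i"] \<sigma>[of "length b - 1"] i by simp_all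
  moreover have "i \<le> \<sigma> i" using adv[of 0 i] i by simp
  ultimately have "\<sigma> i = i" using i by linarith
  then show ?thesis using \<sigma>[OF i] by simp
qed

section \<open>Distortion of cylinders under perturbation\<close>

lemma CPLIFS_cylinder_interval:
  assumes F: "is_CPLIFS m f bs rs" and w: "set w \<subseteq> {..<m}"
  obtains p q where "p < q" "cylinder m f w = {p..q}"
proof -
  obtain c L where cL: "0 < c" "\<And>k i. k < m \<Longrightarrow> i \<le> length (bs k) \<Longrightarrow> c \<le> \<bar>rs k ! i\<bar>"
    "\<And>k i. k < m \<Longrightarrow> i \<le> length (bs k) \<Longrightarrow> \<bar>rs k ! i\<bar> \<le> L"
    using CPLIFS_slope_bounds[OF F] by metis
  obtain p q where pq: "p < q" "base_int m f = {p..q}" using CPLIFS_base_int[OF F] .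
  have "length (bs k) \<le> (\<Sum>k<m. length (bs k))" if "k < m" for k
    using that by (intro member_le_sum) auto
  then show ?thesis
    using CPLIFS_word_interval[OF F pq(1) cL _ w] that pq(2) unfolding cylinder_def by metis
qed

lemma CPLIFS_cylinder_bounds:
  assumes F: "is_CPLIFS m f bs rs"
  obtains K \<theta> K' \<mu> where "\<theta> < 0"
    "\<And>w. set w \<subseteq> {..<m} \<Longrightarrow> 0 < ilen (cylinder m f w)"
    "\<And>w. set w \<subseteq> {..<m} \<Longrightarrow> ln (ilen (cylinder m f w)) \<le> K + \<theta> * real (length w)"
    "\<And>w. set w \<subseteq> {..<m} \<Longrightarrow> K' + \<mu> * real (length w) \<le> ln (ilen (cylinder m f w))"
proof -
  obtain c L where cL: "0 < c" "0 < L" "L < 1"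
    "\<And>k i. k < m \<Longrightarrow> i \<le> length (bs k) \<Longrightarrow> c \<le> \<bar>rs k ! i\<bar>"
    "\<And>k i. k < m \<Longrightarrow> i \<le> length (bs k) \<Longrightarrow> \<bar>rs k ! i\<bar> \<le> L"
    using CPLIFS_slope_bounds[OF F] by metis
  obtain p q where pq: "p < q" "base_int m f = {p..q}" using CPLIFS_base_int[OF F] .
  define l where "l = (\<Sum>k<m. length (bs k))"
  have l: "length (bs k) \<le> l" if "k < m" for k
    unfolding l_def using that by (intro member_le_sum) auto
  have *: "0 < ilen (cylinder m f w)"
    "ln (ilen (cylinder m f w)) \<le> ln (q - p) + ln L * real (length w)"
    "ln (q - p) + ln (c / 2 ^ l) * real (length w) \<le> ln (ilen (cylinder m f w))" if w: "set w \<subseteq> {..<m}" for w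
  proof -
    obtain p' q' where 1: "p' < q'" "cylinder m f w = {p'..q'}"
      "(c / 2 ^ l) ^ length w * (q - p) \<le> q' - p'" "q' - p' \<le> L ^ length w * (q - p)"
      using CPLIFS_word_interval[OF F pq(1) cL(1,4,5) l w] unfolding cylinder_def pq(2) by blast
    have len: "ilen (cylinder m f w) = q' - p'" using 1 by simp
    show "0 < ilen (cylinder m f w)" using len 1 by simp
    have "ln (q' - p') \<le> ln (L ^ length w * (q - p))" using 1 by (subst ln_le_cancel_iff) auto
    also have "\<dots> = ln (q - p) + ln L * real (length w)" using cL pq by (simp add: ln_mult ln_realpow)
    finally show "ln (ilen (cylinder m f w)) \<le> ln (q - p) + ln L * real (length w)" using len by simp
    have "0 < (c / 2 ^ l) ^ length w * (q - p)" using cL pq by simp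
    then have "ln ((c / 2 ^ l) ^ length w * (q - p)) \<le> ln (q' - p')" using 1 by (subst ln_le_cancel_iff) auto
    moreover have "ln ((c / 2 ^ l) ^ length w * (q - p)) = ln (q - p) + ln (c / 2 ^ l) * real (length w)"
      using cL pq by (subst ln_mult) (auto simp: ln_realpow)
    ultimately show "ln (q - p) + ln (c / 2 ^ l) * real (length w) \<le> ln (ilen (cylinder m f w))" using len by simp
  qed
  have "ln L < 0" using cL by simp
  from that[OF this *] show ?thesis by blast
qed

text \<open>\<open>nat_dim\<close> is a definite description, so existence and uniqueness of the
  zero are both required before anything can be said about it.\<close>

lemma nat_dim_zero:
  assumes F: "is_CPLIFS m f bs rs"
  shows "0 \<le> nat_dim m f" "nat_pressure m f (nat_dim m f) = 0"
proof -
  obtain K \<theta> K' \<mu> where "\<theta> < 0"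
    "\<And>w. set w \<subseteq> {..<m} \<Longrightarrow> 0 < ilen (cylinder m f w)"
    "\<And>w. set w \<subseteq> {..<m} \<Longrightarrow> ln (ilen (cylinder m f w)) \<le> K + \<theta> * real (length w)"
    "\<And>w. set w \<subseteq> {..<m} \<Longrightarrow> K' + \<mu> * real (length w) \<le> ln (ilen (cylinder m f w))"
    using CPLIFS_cylinder_bounds[OF F] by metis
  then have "\<exists>!s. 0 \<le> s \<and> nat_pressure m f s = 0"
    unfolding nat_pressure_eq by (intro pressure_ex1_zero[OF CPLIFS_D(1)[OF F]])
  from theI'[OF this] show "0 \<le> nat_dim m f" "nat_pressure m f (nat_dim m f) = 0"
    unfolding nat_dim_def by auto
qed

text \<open>The logarithmic ratio of one step lies in an interval given by \<open>c\<close> and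
  \<open>l\<close> alone, so the ratios of two systems sharing these constants differ by at most its
  length.\<close>

lemma CPLIFS_step_ratio:
  assumes F: "is_CPLIFS m f bs rs" and k: "k < m" and pq: "p < q"
    and c: "0 < c" "\<And>i. i \<le> length (bs k) \<Longrightarrow> c \<le> \<bar>rs k ! i\<bar>" and l: "length (bs k) \<le> l"
  shows "ln (c / 2 ^ l) \<le> ln (ilen (f k ` {p..q})) - ln (q - p)" "ln (ilen (f k ` {p..q})) - ln (q - p) \<le> 0"
proof -
  obtain p' q' where 1: "p' < q'" "f k ` {p..q} = {p'..q'}"
    "c / 2 ^ length (bs k) * (q - p) \<le> q' - p'" "q' - p' \<le> 1 * (q - p)"
    using CPLIFS_image_interval[OF F k pq c, of 1] CPLIFS_D(4)[OF F k] by (metis less_imp_le)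
  have "c / 2 ^ l \<le> c / 2 ^ length (bs k)" using l c(1) by (intro divide_left_mono) auto
  then have "c / 2 ^ l * (q - p) \<le> q' - p'" using 1(3) pq mult_right_mono[of _ _ "q - p"] by fastforce
  then have "ln (c / 2 ^ l * (q - p)) \<le> ln (q' - p')" using 1 c(1) pq by (subst ln_le_cancel_iff) auto
  moreover have "ln (c / 2 ^ l * (q - p)) = ln (c / 2 ^ l) + ln (q - p)" using c(1) pq by (subst ln_mult) auto
  ultimately show "ln (c / 2 ^ l) \<le> ln (ilen (f k ` {p..q})) - ln (q - p)" using 1 by simp
  show "ln (ilen (f k ` {p..q})) - ln (q - p) \<le> 0" using 1 pq by simp
qed

lemma cylinder_distortion:
  assumes F: "is_CPLIFS m f bs rs" and no: "no_exact_overlap m f bs rs" and \<eta>: "0 < \<eta>"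
  obtains \<delta> where "0 < \<delta>"
    "\<And>g cs qs. is_CPLIFS m g cs qs \<Longrightarrow> cplifs_close \<delta> m f bs rs g cs qs \<Longrightarrow>
      \<exists>K. \<forall>w. set w \<subseteq> {..<m} \<longrightarrow>
        \<bar>ln (ilen (cylinder m g w)) - ln (ilen (cylinder m f w))\<bar> \<le> K + \<eta> * real (length w)"
proof -
  obtain c L where cL: "0 < c" "0 < L" "L < 1"
    "\<And>k i. k < m \<Longrightarrow> i \<le> length (bs k) \<Longrightarrow> c \<le> \<bar>rs k ! i\<bar>"
    "\<And>k i. k < m \<Longrightarrow> i \<le> length (bs k) \<Longrightarrow> \<bar>rs k ! i\<bar> \<le> L"
    using CPLIFS_slope_bounds[OF F] by metis
  have lip: "\<bar>f k x - f k y\<bar> \<le> L * \<bar>x - y\<bar>" if "k < m" for k x y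
    using CPLIFS_lipschitz[OF F that cL(5)[OF that]] .
  have lip1: "\<bar>f k x - f k y\<bar> \<le> \<bar>x - y\<bar>" if "k < m" for k x y
    using lip[OF that, of x y] mult_right_mono[of L 1 "\<bar>x - y\<bar>"] cL(3) by simp
  define l where "l = (\<Sum>k<m. length (bs k))"
  have l: "length (bs k) \<le> l" if "k < m" for k
    unfolding l_def using that by (intro member_le_sum) auto
  \<comment> \<open>Since \<delta> will be at most 1, logarithms of slopes change by at most 1. Thus
    \<open>c'\<close> bounds the slopes of every admissible \<open>g\<close> as well, and
    \<open>C\<close> is independent of \<open>g\<close>.\<close>
  define c' where "c' = c / exp 1"
  have c': "0 < c'" "c' \<le> c" using cL(1) by (auto simp: c'_def divide_le_eq)
  define C where "C = - ln (c' / 2 ^ l)"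
  have "c < 1" using cL(4)[of 0 0] cL(5)[of 0 0] cL(3) CPLIFS_D(1)[OF F] by simp
  moreover have "(1::real) \<le> 2 ^ l" by simp
  ultimately have "c' \<le> 2 ^ l" using c' by linarith
  then have "c' / 2 ^ l \<le> 1" by (simp add: divide_le_eq)
  then have C: "0 \<le> C" using c' by (simp add: C_def)
  define B where "B = card (breakpoints m bs)"
  \<comment> \<open>At most \<open>B\<close> hits per block of \<open>N\<close> letters, each
    costing \<open>C\<close>: this \<open>N\<close> brings their cost per letter below
    \<open>\<eta> / 2\<close>.\<close>
  obtain N :: nat where N0: "2 * C * B / \<eta> < N" using reals_Archimedean2 by blast
  have "0 \<le> 2 * C * B / \<eta>" using C \<eta> by simp
  then have "0 < real N" using N0 by linarith
  moreover have "2 * C * B < N * \<eta>" using N0 \<eta> by (simp add: pos_divide_less_eq)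
  ultimately have N: "0 < N" "C * B / N \<le> \<eta> / 2" by (simp_all add: pos_divide_le_eq ac_simps)
  obtain d where d: "0 < d" "\<And>u k i. set u \<subseteq> {..<m} \<Longrightarrow> length u \<le> N \<Longrightarrow> k < m \<Longrightarrow> i < length (bs k) \<Longrightarrow>
    d < \<bar>comp_word f u (f k (bs k ! i)) - bs k ! i\<bar>"
    using breakpoint_separation[OF F no] by metis
  obtain \<gamma> where \<gamma>: "0 < \<gamma>" "\<And>k i. k < m \<Longrightarrow> Suc i < length (bs k) \<Longrightarrow> \<gamma> < bs k ! Suc i - bs k ! i"
  proof -
    let ?X = "{(k, i). k < m \<and> Suc i < length (bs k)}"
    let ?V = "(\<lambda>(k, i). bs k ! Suc i - bs k ! i) ` ?X"
    have "finite ?X" by (rule finite_subset[OF _ finite_breakpoints[of m bs]]) (auto simp: breakpoints_def)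
    moreover have "bs k ! i < bs k ! Suc i" if "k < m" "Suc i < length (bs k)" for k i
      using CPLIFS_D(2)[OF F that(1)] that(2) by (simp add: sorted_wrt_iff_nth_less)
    ultimately have "\<exists>\<gamma>>0. \<forall>v\<in>?V. \<gamma> < v" by (intro finite_pos_lower_bound) auto
    then obtain \<gamma> where \<gamma>: "0 < \<gamma>" "\<forall>v\<in>?V. \<gamma> < v" by blast
    show ?thesis by (rule that[OF \<gamma>(1)]) (use \<gamma>(2) in auto)
  qed
  obtain \<kappa> where \<kappa>: "0 < \<kappa>" "\<And>k i. k < m \<Longrightarrow> i < length (bs k) \<Longrightarrow> \<kappa> < \<bar>rs k ! Suc i - rs k ! i\<bar>"
  proof -
    let ?V = "(\<lambda>(k, i). \<bar>rs k ! Suc i - rs k ! i\<bar>) ` breakpoints m bs"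
    have "0 < v" if "v \<in> ?V" for v using that CPLIFS_D(6)[OF F, THEN not_sym] by (auto simp: breakpoints_def)
    then have "\<exists>\<kappa>>0. \<forall>v\<in>?V. \<kappa> < v" by (intro finite_pos_lower_bound finite_imageI finite_breakpoints)
    then obtain \<kappa> where \<kappa>: "0 < \<kappa>" "\<forall>v\<in>?V. \<kappa> < v" by blast
    show ?thesis by (rule that[OF \<kappa>(1)]) (use \<kappa>(2) in \<open>auto simp: breakpoints_def\<close>)
  qed
  \<comment> \<open>\<open>4 * r \<le> d\<close> separates returns for hits of radius
    \<open>2 * r\<close>; \<open>2 * r \<le> \<gamma>\<close> is the gap condition of
    \<open>breakpoints_close\<close>.\<close>
  define r where "r = min (d / 4) (\<gamma> / 2)"
  have r: "0 < r" "4 * r \<le> d" "2 * r \<le> \<gamma>" using d \<gamma> by (auto simp: r_def)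
  \<comment> \<open>In order: control of the slopes of \<open>g\<close> through \<open>c'\<close>,
    the cost of a good step, the detection of breaking points, and a shadowing error of at most
    \<open>r / 2\<close>.\<close>
  define \<delta> where "\<delta> = Min {1, \<eta> / 2, r * \<kappa> / 4, r * (1 - L) / 2}"
  have \<delta>: "0 < \<delta>" using \<eta> r \<kappa>(1) cL by (simp add: \<delta>_def)
  have \<delta>': "\<delta> \<le> 1" "\<delta> \<le> \<eta> / 2" "\<delta> \<le> r * \<kappa> / 4" "\<delta> \<le> r * (1 - L) / 2" by (auto simp: \<delta>_def)
  have \<delta>L: "\<delta> / (1 - L) \<le> r / 2" using \<delta>'(4) cL(3) by (simp add: pos_divide_le_eq)
  show ?thesis
  proof (rule that[OF \<delta>])
    fix g cs qs assume G: "is_CPLIFS m g cs qs" and close: "cplifs_close \<delta> m f bs rs g cs qs"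
    have len: "length (cs k) = length (bs k)" if "k < m" for k
      using close that by (simp add: cplifs_close_def)
    have slope: "\<bar>ln \<bar>rs k ! i\<bar> - ln \<bar>qs k ! i\<bar>\<bar> \<le> \<delta>" if "k < m" "i \<le> length (bs k)" for k i
      using close that unfolding cplifs_close_def by (auto intro: less_imp_le)
    have near: "\<bar>f k x - g k x\<bar> \<le> \<delta>" if "k < m" for k x
    proof -
      have "ereal \<bar>f k x - g k x\<bar> \<le> (SUP x. ereal \<bar>f k x - g k x\<bar>)" by (rule SUP_upper) simp
      also have "\<dots> < ereal \<delta>" using close that unfolding cplifs_close_def by blast
      finally show ?thesis by simp
    qed
    have bclose: "\<bar>cs k ! i - bs k ! i\<bar> < r" if k: "k < m" and i: "i < length (bs k)" for k i
    proof (rule breakpoints_close[OF CPLIFS_pl_map[OF F k] CPLIFS_pl_map[OF G k] len[OF k] _ r(1) _ near[OF k] i])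
      show "2 * r \<le> bs k ! Suc i - bs k ! i" if "Suc i < length (bs k)" for i
        using \<gamma>(2)[OF k that] r(3) by simp
      show "4 * \<delta> < r * \<bar>rs k ! Suc i - rs k ! i\<bar>" if "i < length (bs k)" for i
        using mult_strict_left_mono[OF \<kappa>(2)[OF k that] r(1)] \<delta>'(3) by simp
    qed
    have gslope: "c' \<le> \<bar>qs k ! i\<bar>" if "k < m" "i \<le> length (cs k)" for k i
    proof -
      have i: "i \<le> length (bs k)" using that len by simp
      have "ln c \<le> ln \<bar>rs k ! i\<bar>" using cL(1) cL(4)[OF that(1) i] by (subst ln_le_cancel_iff) auto
      then have "ln c - 1 \<le> ln \<bar>qs k ! i\<bar>" using slope[OF that(1) i] \<delta>'(1) by linarith
      then have "exp (ln c - 1) \<le> exp (ln \<bar>qs k ! i\<bar>)" by simp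
      then show ?thesis using CPLIFS_D(5)[OF G that] cL(1) by (simp add: c'_def exp_diff)
    qed
    obtain p q where pq: "p < q" "base_int m f = {p..q}" using CPLIFS_base_int[OF F] .
    obtain p' q' where pq': "p' < q'" "base_int m g = {p'..q'}" using CPLIFS_base_int[OF G] .
    \<comment> \<open>\<open>M\<close> bounds the distance from \<open>p\<close> to any point of
      either base interval. It depends on \<open>g\<close>, and so does \<open>j\<close>; both
      affect only the final \<open>K\<close>.\<close>
    define M where "M = \<bar>q - p\<bar> + \<bar>p' - p\<bar> + \<bar>q' - p\<bar> + 1"
    have M: "0 < M" by (simp add: M_def)
    obtain j where j: "L ^ j < r / 2 / M" using real_arch_pow_inv[of "r / 2 / M" L] r M cL by auto
    have small: "L ^ n * y \<le> r / 2" if "j \<le> n" "y \<le> M" "0 \<le> y" for n y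
    proof -
      have "L ^ n * y \<le> L ^ j * M" using that cL M by (intro mult_mono power_decreasing) auto
      also have "\<dots> \<le> r / 2" using j M by (simp add: pos_less_divide_eq)
      finally show ?thesis .
    qed
    \<comment> \<open>From depth \<open>j\<close> on, the cylinders of both systems stay within
      \<open>r\<close> of one reference orbit, that of \<open>p\<close> under
      \<open>f\<close>.\<close>
    have inF: "cylinder m f w \<subseteq> {comp_word f w p - r..comp_word f w p + r}"
      if w: "set w \<subseteq> {..<m}" "j \<le> length w" for w
      unfolding cylinder_def pq(2)
    proof (rule image_subsetI)
      fix y assume y: "y \<in> {p..q}"
      have "\<bar>comp_word f w y - comp_word f w p\<bar> \<le> L ^ length w * \<bar>y - p\<bar> + 0 / (1 - L)"
        by (rule comp_word_perturb[where m = m, OF _ _ cL(3) _ w(1)]) (simp_all add: lip cL(2) less_imp_le)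
      moreover have "L ^ length w * \<bar>y - p\<bar> \<le> r / 2"
        using y by (intro small w(2)) (auto simp: M_def)
      ultimately have "\<bar>comp_word f w y - comp_word f w p\<bar> \<le> r" using r(1) by simp
      then show "comp_word f w y \<in> {comp_word f w p - r..comp_word f w p + r}"
        unfolding atLeastAtMost_iff by linarith
    qed
    have inG: "cylinder m g w \<subseteq> {comp_word f w p - r..comp_word f w p + r}"
      if w: "set w \<subseteq> {..<m}" "j \<le> length w" for w
      unfolding cylinder_def pq'(2)
    proof (rule image_subsetI)
      fix y assume y: "y \<in> {p'..q'}"
      have "\<bar>comp_word g w y - comp_word f w p\<bar> \<le> L ^ length w * \<bar>y - p\<bar> + \<delta> / (1 - L)"
        by (rule comp_word_perturb[where m = m, OF _ _ cL(3) _ w(1)]) (simp_all add: lip cL(2) near \<delta> less_imp_le)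
      moreover have "L ^ length w * \<bar>y - p\<bar> \<le> r / 2"
        using y by (intro small w(2)) (auto simp: M_def)
      ultimately have "\<bar>comp_word g w y - comp_word f w p\<bar> \<le> r" using \<delta>L by linarith
      then show "comp_word g w y \<in> {comp_word f w p - r..comp_word f w p + r}"
        unfolding atLeastAtMost_iff by linarith
    qed
    define E where "E = (\<lambda>w. ln (ilen (cylinder m g w)) - ln (ilen (cylinder m f w)))"
    \<comment> \<open>Any step changes \<open>E\<close> by at most \<open>C\<close>. Without a hit
      at a deep level, both cylinders lie in pieces with the same index, so both maps scale them
      exactly by the corresponding slopes.\<close>
    have step: "\<bar>E (k # w) - E w\<bar> \<le> C"
      "\<not> (\<exists>i<length (bs k). \<bar>comp_word f w p - bs k ! i\<bar> \<le> 2 * r) \<Longrightarrow> j \<le> length w \<Longrightarrow> \<bar>E (k # w) - E w\<bar> \<le> \<delta>"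
      if w: "set w \<subseteq> {..<m}" and k: "k < m" for k w
    proof -
      obtain P Q where PQ: "P < Q" "cylinder m f w = {P..Q}" using CPLIFS_cylinder_interval[OF F w] .
      obtain P' Q' where PQ': "P' < Q'" "cylinder m g w = {P'..Q'}" using CPLIFS_cylinder_interval[OF G w] .
      have img: "cylinder m f (k # w) = f k ` {P..Q}" "cylinder m g (k # w) = g k ` {P'..Q'}"
        by (simp_all only: cylinder_Cons PQ(2) PQ'(2))
      have E: "E (k # w) - E w = (ln (ilen (g k ` {P'..Q'})) - ln (Q' - P')) - (ln (ilen (f k ` {P..Q})) - ln (Q - P))"
        unfolding E_def img PQ(2) PQ'(2) ilen_interval[OF less_imp_le[OF PQ(1)]]
          ilen_interval[OF less_imp_le[OF PQ'(1)]] by linarith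
      have lF: "c' \<le> \<bar>rs k ! i\<bar>" if "i \<le> length (bs k)" for i using cL(4)[OF k that] c' by simp
      have lG: "length (cs k) \<le> l" using l[OF k] len[OF k] by simp
      show "\<bar>E (k # w) - E w\<bar> \<le> C"
        using CPLIFS_step_ratio[OF F k PQ(1) c'(1) lF l[OF k]]
          CPLIFS_step_ratio[OF G k PQ'(1) c'(1) gslope[OF k] lG]
        unfolding E C_def by linarith
      assume nohit: "\<not> (\<exists>i<length (bs k). \<bar>comp_word f w p - bs k ! i\<bar> \<le> 2 * r)" and jw: "j \<le> length w"
      define x where "x = comp_word f w p"
      have "bs k ! i \<le> x - 2 * r \<or> x + 2 * r \<le> bs k ! i" if "i < length (bs k)" for i
        using nohit that unfolding x_def by force
      then obtain i where i: "i \<le> length (bs k)" "{x - 2 * r..x + 2 * r} \<subseteq> piece (bs k) i"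
        using interval_subset_piece[of "x - 2 * r" "x + 2 * r" "bs k"] r by auto
      have iG: "i \<le> length (cs k)" using i len[OF k] by simp
      have "{x - r..x + r} \<subseteq> piece (cs k) i"
        using piece_perturb[OF i r(1) len[OF k]] bclose[OF k] by blast
      then have subG: "{P'..Q'} \<subseteq> piece (cs k) i"
        using inG[OF w jw] unfolding PQ'(2) x_def[symmetric] by (rule order_trans[rotated])
      have "{x - r..x + r} \<subseteq> {x - 2 * r..x + 2 * r}" using r(1) by auto
      then have "{x - r..x + r} \<subseteq> piece (bs k) i" using i(2) by (rule order_trans)
      then have subF: "{P..Q} \<subseteq> piece (bs k) i"
        using inF[OF w jw] unfolding PQ(2) x_def[symmetric] by (rule order_trans[rotated])
      have "ilen (f k ` {P..Q}) = \<bar>rs k ! i\<bar> * (Q - P)" "ilen (g k ` {P'..Q'}) = \<bar>qs k ! i\<bar> * (Q' - P')"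
        by (rule CPLIFS_image_affine[OF F k PQ(1) i(1) subF] CPLIFS_image_affine[OF G k PQ'(1) iG subG])+
      then have "E (k # w) - E w = ln \<bar>qs k ! i\<bar> - ln \<bar>rs k ! i\<bar>"
        unfolding E using PQ(1) PQ'(1) CPLIFS_D(5)[OF F k i(1)] CPLIFS_D(5)[OF G k iG] by (simp add: ln_mult)
      then show "\<bar>E (k # w) - E w\<bar> \<le> \<delta>" using slope[OF k i(1)] by simp
    qed
    \<comment> \<open>Every letter pays \<delta>, and \<open>C\<close> is paid in addition for each
      of the first \<open>j\<close> steps and for each hit.\<close>
    have E_le: "\<bar>E w\<bar> \<le> \<bar>E []\<bar> + \<delta> * length w + C * (real (min (length w) j) + real (hits f bs (2 * r) p w))"
      if "set w \<subseteq> {..<m}" for w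
      using that
    proof (induction w)
      case (Cons k w)
      define h where "h = real (min (length w) j) + real (hits f bs (2 * r) p w)"
      define h' where "h' = real (min (length (k # w)) j) + real (hits f bs (2 * r) p (k # w))"
      have w: "set w \<subseteq> {..<m}" "k < m" using Cons.prems by auto
      have IH: "\<bar>E w\<bar> \<le> \<bar>E []\<bar> + \<delta> * length w + C * h" using Cons.IH[OF w(1)] by (simp add: h_def)
      have hh: "h \<le> h'" by (simp add: h_def h'_def)
      have "\<bar>E (k # w) - E w\<bar> \<le> \<delta> + C * (h' - h)"
      proof (cases "(\<exists>i<length (bs k). \<bar>comp_word f w p - bs k ! i\<bar> \<le> 2 * r) \<or> length w < j")
        case True
        then have "1 \<le> h' - h" by (auto simp: h_def h'_def)
        then have "C * 1 \<le> C * (h' - h)" using C by (intro mult_left_mono)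
        then show ?thesis using step(1)[OF w] \<delta> by linarith
      next
        case False
        then have "\<not> (\<exists>i<length (bs k). \<bar>comp_word f w p - bs k ! i\<bar> \<le> 2 * r)" "j \<le> length w"
          by (blast, linarith)
        from step(2)[OF w this] show ?thesis using mult_nonneg_nonneg[of C "h' - h"] C hh by linarith
      qed
      then have "\<bar>E (k # w)\<bar> \<le> \<bar>E []\<bar> + \<delta> * length w + C * h + (\<delta> + C * (h' - h))"
        using IH by linarith
      also have "\<dots> = \<bar>E []\<bar> + \<delta> * length (k # w) + C * h'" by (simp add: algebra_simps)
      finally show ?case unfolding h'_def .
    qed simp
    show "\<exists>K. \<forall>w. set w \<subseteq> {..<m} \<longrightarrow>
        \<bar>ln (ilen (cylinder m g w)) - ln (ilen (cylinder m f w))\<bar> \<le> K + \<eta> * real (length w)"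
    proof (intro exI allI impI)
      fix w assume w: "set w \<subseteq> {..<m}"
      have sep: "2 * (2 * r) < \<bar>comp_word f u (f k (bs k ! i)) - bs k ! i\<bar>"
        if "set u \<subseteq> {..<m}" "length u \<le> N" "k < m" "i < length (bs k)" for u k i
        using d(2)[OF that] r(2) by simp
      have "hits f bs (2 * r) p w \<le> B * (length w div N + 1)"
        unfolding B_def by (rule hits_le[where f = f and bs = bs and m = m, OF lip1 sep N(1) w])
      then have "real (hits f bs (2 * r) p w) \<le> real (B * (length w div N + 1))"
        by (simp only: of_nat_le_iff)
      then have "real (hits f bs (2 * r) p w) \<le> real B * (real (length w div N) + 1)"
        unfolding of_nat_mult of_nat_add of_nat_1 .
      also have "\<dots> \<le> real B * (real (length w) / real N + 1)"
        using of_nat_div_le_of_nat by (intro mult_left_mono add_mono) auto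
      finally have "real (min (length w) j) + real (hits f bs (2 * r) p w)
        \<le> real j + real B * (real (length w) / real N + 1)" by simp
      from mult_left_mono[OF this C]
      have 1: "C * (real (min (length w) j) + real (hits f bs (2 * r) p w))
        \<le> C * (j + B) + C * B / N * length w" by (simp add: algebra_simps)
      have 2: "C * B / N * length w \<le> \<eta> / 2 * length w" "\<delta> * length w \<le> \<eta> / 2 * length w"
        using N(2) \<delta>'(2) by (intro mult_right_mono; simp)+
      have "\<bar>E w\<bar> \<le> \<bar>E []\<bar> + C * (j + B) + \<eta> * length w"
        using E_le[OF w] 1 2 by linarith
      then show "\<bar>ln (ilen (cylinder m g w)) - ln (ilen (cylinder m f w))\<bar> \<le>
        \<bar>E []\<bar> + C * (j + B) + \<eta> * real (length w)" by (simp add: E_def)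
    qed
  qed
qed

section \<open>From distortion of cylinders to continuity of the natural dimension\<close>

theorem theorem1p3:
  fixes m :: nat and f :: "nat \<Rightarrow> real \<Rightarrow> real" and bs rs :: "nat \<Rightarrow> real list"
  assumes "is_CPLIFS m f bs rs"
    and "no_exact_overlap m f bs rs"
  shows "\<forall>\<epsilon>>0. \<exists>\<delta>>0. \<forall>g cs qs. is_CPLIFS m g cs qs \<and> cplifs_close \<delta> m f bs rs g cs qs
           \<longrightarrow> \<bar>nat_dim m f - nat_dim m g\<bar> < \<epsilon>"
proof (intro allI impI)
  fix \<epsilon> :: real assume \<epsilon>: "0 < \<epsilon>"
  note F = assms(1)
  obtain K \<theta> where \<theta>: "\<theta> < 0"
    and posF: "\<And>w. set w \<subseteq> {..<m} \<Longrightarrow> 0 < ilen (cylinder m f w)"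
    and up: "\<And>w. set w \<subseteq> {..<m} \<Longrightarrow> ln (ilen (cylinder m f w)) \<le> K + \<theta> * real (length w)"
    using CPLIFS_cylinder_bounds[OF F] by metis
  have m: "0 < m" using CPLIFS_D(1)[OF F] by simp
  define s where "s = nat_dim m f"
  have s: "0 \<le> s" "nat_pressure m f s = 0" using nat_dim_zero[OF F] by (simp_all add: s_def)
  \<comment> \<open>At exponent \<open>s + \<epsilon>\<close> the pressure error
    \<open>(s + \<epsilon>) * \<eta>\<close> is then half of the decay
    \<open>\<epsilon> * - \<theta>\<close> that is guaranteed over the distance \<epsilon>.\<close>
  define \<eta> where "\<eta> = \<epsilon> * - \<theta> / (2 * (s + \<epsilon>))"
  have \<eta>: "0 < \<eta>" using \<epsilon> \<theta> s(1) unfolding \<eta>_def by (intro divide_pos_pos mult_pos_pos) auto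
  have \<eta>s: "(s + \<epsilon>) * \<eta> = \<epsilon> * - \<theta> / 2" using \<epsilon> s(1) by (simp add: \<eta>_def field_simps)
  obtain \<delta> where \<delta>: "0 < \<delta>" and dist: "\<And>g cs qs. is_CPLIFS m g cs qs \<Longrightarrow> cplifs_close \<delta> m f bs rs g cs qs \<Longrightarrow>
      \<exists>K. \<forall>w. set w \<subseteq> {..<m} \<longrightarrow>
        \<bar>ln (ilen (cylinder m g w)) - ln (ilen (cylinder m f w))\<bar> \<le> K + \<eta> * real (length w)"
    using cylinder_distortion[OF assms \<eta>] by blast
  have "\<bar>nat_dim m f - nat_dim m g\<bar> < \<epsilon>"
    if G: "is_CPLIFS m g cs qs" and close: "cplifs_close \<delta> m f bs rs g cs qs" for g cs qs
  proof -
    define t where "t = nat_dim m g"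
    have t: "0 \<le> t" "nat_pressure m g t = 0" using nat_dim_zero[OF G] by (simp_all add: t_def)
    have posG: "0 < ilen (cylinder m g w)" if "set w \<subseteq> {..<m}" for w
      using CPLIFS_cylinder_interval[OF G that] by force
    obtain K' where K': "\<And>w. set w \<subseteq> {..<m} \<Longrightarrow>
        \<bar>ln (ilen (cylinder m g w)) - ln (ilen (cylinder m f w))\<bar> \<le> K' + \<eta> * real (length w)"
      using dist[OF G close] by blast
    have le: "t * ln (ilen (cylinder m g w)) \<le> t * ln (ilen (cylinder m f w)) + t * K' + t * \<eta> * real (length w)"
      "t * ln (ilen (cylinder m f w)) \<le> t * ln (ilen (cylinder m g w)) + t * K' + t * \<eta> * real (length w)"
      if "set w \<subseteq> {..<m}" for w
    proof -
      have "ln (ilen (cylinder m g w)) \<le> ln (ilen (cylinder m f w)) + (K' + \<eta> * real (length w))"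
        "ln (ilen (cylinder m f w)) \<le> ln (ilen (cylinder m g w)) + (K' + \<eta> * real (length w))"
        using K'[OF that] by linarith+
      from this[THEN mult_left_mono, OF t(1)] show
        "t * ln (ilen (cylinder m g w)) \<le> t * ln (ilen (cylinder m f w)) + t * K' + t * \<eta> * real (length w)"
        "t * ln (ilen (cylinder m f w)) \<le> t * ln (ilen (cylinder m g w)) + t * K' + t * \<eta> * real (length w)"
        by (simp_all add: algebra_simps)
    qed
    have gf: "0 \<le> ereal (t * \<eta>) + nat_pressure m f t"
      using pressure_compare[OF m posG posF le(1)] t(2) unfolding nat_pressure_eq by simp
    have fg: "nat_pressure m f t \<le> ereal (t * \<eta>)"
      using pressure_compare[OF m posF posG le(2)] t(2) unfolding nat_pressure_eq by simp
    obtain \<phi> where \<phi>: "nat_pressure m f t = ereal \<phi>" using gf fg by (cases "nat_pressure m f t") auto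
    have decay: "nat_pressure m f b \<le> ereal ((b - a) * \<theta>) + nat_pressure m f a" if "a \<le> b" for a b
      using pressure_decay[OF m posF up that] unfolding nat_pressure_eq by simp
    have b: "- (t * \<eta>) \<le> \<phi>" "\<phi> \<le> t * \<eta>" using gf fg \<phi> by auto
    \<comment> \<open>There is no bound on \<open>t\<close> beforehand and the error
      \<open>t * \<eta>\<close> grows with it. Since \<open>\<eta> \<le> - \<theta> / 2\<close>, the
      decay \<open>(t - s) * - \<theta>\<close> grows faster, so the margin at
      \<open>s + \<epsilon>\<close> persists beyond it.\<close>
    have "t < s + \<epsilon>"
    proof (rule ccontr)
      assume "\<not> ?thesis"
      then have ts: "s + \<epsilon> \<le> t" by simp
      then have "\<phi> \<le> (t - s) * \<theta>" using decay[of s t] s \<phi> \<epsilon> by simp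
      then have le: "(t - s) * - \<theta> \<le> t * \<eta>" using b by simp
      have "\<eta> \<le> - \<theta> / 2"
      proof -
        have "\<epsilon> * \<eta> \<le> (s + \<epsilon>) * \<eta>" using s \<eta> by simp
        then have "\<epsilon> * \<eta> \<le> \<epsilon> * (- \<theta> / 2)" using \<eta>s by simp
        then show ?thesis using \<epsilon> mult_le_cancel_left_pos by blast
      qed
      then have "(t - (s + \<epsilon>)) * \<eta> \<le> (t - (s + \<epsilon>)) * (- \<theta> / 2)" using ts by (intro mult_left_mono) auto
      moreover have "t * \<eta> = (t - (s + \<epsilon>)) * \<eta> + (s + \<epsilon>) * \<eta>" by (simp add: algebra_simps)
      moreover have "(t - (s + \<epsilon>)) * (- \<theta> / 2) + \<epsilon> * - \<theta> / 2 = (t - s) * (- \<theta> / 2)" by (simp add: field_simps)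
      ultimately have "(t - s) * - \<theta> \<le> (t - s) * (- \<theta> / 2)" using le \<eta>s by linarith
      moreover have "(t - s) * (- \<theta> / 2) < (t - s) * - \<theta>" using ts \<theta> \<epsilon> by (intro mult_strict_left_mono) auto
      ultimately show False by simp
    qed
    \<comment> \<open>Here \<open>t\<close> lies below \<open>s\<close>, so the error is already at
      most \<open>(s + \<epsilon>) * \<eta>\<close>.\<close>
    moreover have "s - \<epsilon> < t"
    proof (rule ccontr)
      assume "\<not> ?thesis"
      then have ts: "t + \<epsilon> \<le> s" by simp
      then have "0 \<le> (s - t) * \<theta> + \<phi>" using decay[of t s] s \<phi> \<epsilon> by simp
      then have "(s - t) * - \<theta> \<le> t * \<eta>" using b by simp
      moreover have "t * \<eta> \<le> (s + \<epsilon>) * \<eta>" using ts \<epsilon> \<eta> by (intro mult_right_mono) auto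
      moreover have "\<epsilon> * - \<theta> \<le> (s - t) * - \<theta>" using ts \<theta> by (intro mult_right_mono) auto
      moreover have "0 < \<epsilon> * - \<theta>" using \<epsilon> \<theta> by (simp add: mult_pos_neg)
      ultimately show False using \<eta>s by linarith
    qed
    ultimately show ?thesis by (simp add: s_def t_def abs_less_iff)
  qed
  then show "\<exists>\<delta>>0. \<forall>g cs qs. is_CPLIFS m g cs qs \<and> cplifs_close \<delta> m f bs rs g cs qs
           \<longrightarrow> \<bar>nat_dim m f - nat_dim m g\<bar> < \<epsilon>"
    using \<delta> by blast
qed

end
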